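(* Let $k$ be an algebraically closed field of characteristic $\chi > 0$, let $m, n \in \mathbb{N}$, and let $\mathbf{f} = (f_1,\ldots,f_m)$ be a sequence of algebraically independent (over $k$) polynomials in $k[t_1,\ldots,t_n]$. Then the following are equivalent: (1) $k\langle f_1,\ldots,f_m\rangle = \mathrm{rad}_\chi(k[f_1,\ldots,f_m])$. (2) $\mathbf{f}$ is almost surjective on $k$.
   Context: $\mathbb{N}$ denotes the positive integers and $\mathbb{N}_0 = \mathbb{N}\cup\{0\}$. For $f_1,\ldots,f_m \in k[t_1,\ldots,t_n]$, a polynomial $g \in k[t_1,\ldots,t_n]$ is determined by $(f_1,\ldots,f_m)$ if for all $\mathbf{a},\mathbf{b} \in k^n$ with $f_i(\mathbf{a}) = f_i(\mathbf{b})$ for all $i \in \{1,\ldots,m\}$ we have $g(\mathbf{a}) = g(\mathbf{b})$. $k\langle f_1,\ldots,f_m\rangle$ denotes the set (a $k$-subalgebra) of all polynomials in $k[t_1,\ldots,t_n]$ determined by $(f_1,\ldots,f_m)$. $k[f_1,\ldots,f_m]$ denotes the $k$-subalgebra of $k[t_1,\ldots,t_n]$ generated by $\{f_1,\ldots,f_m\}$. For $P \subseteq k[t_1,\ldots,t_n]$, $\mathrm{rad}_\chi(P) := \{ f \in k[t_1,\ldots,t_n] \mid \text{there is } \nu \in \mathbb{N}_0 \text{ with } f^{\chi^\nu} \in P\}$. An algebraic set in $k^m$ is the set of common zeroes of a set of polynomials in $k[x_1,\ldots,x_m]$. The dimension $\dim(A)$ of an algebraic set $A \subseteq k^m$ with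 vanishing ideal $I(A)$ is the maximal $d \in \{0,\ldots,m\}$ such that there are $i_1 < \cdots < i_d$ in $\{1,\ldots,m\}$ with $I(A) \cap k[x_{i_1},\ldots,x_{i_d}] = \{0\}$, and $\dim(\emptyset) := -1$. $\mathbf{f}$ is almost surjective on $k$ if the Zariski-closure of $k^m \setminus \mathrm{range}(\mathbf{f})$ has dimension at most $m-2$, where $\mathrm{range}(\mathbf{f}) = \{(f_1(\mathbf{a}),\ldots,f_m(\mathbf{a})) \mid \mathbf{a} \in k^n\} \subseteq k^m$. *)

theory Defs
  imports
    "HOL.Hull"
    "HOL-Library.FuncSet"
    "HOL-Library.Poly_Mapping"
    "HOL-Computational_Algebra.Polynomial"
begin

text \<open>Polynomials in the variables \<open>x\<^sub>0, x\<^sub>1, \<dots>\<close>: the exponent vector of a monomial is an element of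
  \<^typ>\<open>nat \<Rightarrow>\<^sub>0 nat\<close>, and multiplication is the convolution product of \<^theory>\<open>HOL-Library.Poly_Mapping\<close>.\<close>

type_synonym 'k mpoly = "(nat \<Rightarrow>\<^sub>0 nat) \<Rightarrow>\<^sub>0 'k"

text \<open>The polynomials in which only variables with index in \<open>X\<close> occur; thus \<open>poly_ring {..<n}\<close> is
  the polynomial ring in the \<open>n\<close> variables \<open>x\<^sub>0, \<dots>, x\<^sub>n\<^sub>-\<^sub>1\<close>.\<close>

definition poly_ring :: "nat set \<Rightarrow> 'k::zero mpoly set" where
  "poly_ring X = {p. \<forall>e \<in> Poly_Mapping.keys p. Poly_Mapping.keys e \<subseteq> X}"

definition mconst :: "'k::zero \<Rightarrow> 'k mpoly" where
  "mconst c = Poly_Mapping.single 0 c"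

text \<open>The value of \<open>p\<close> when every coefficient \<open>c\<close> is replaced by \<open>h c\<close> and every variable \<open>x\<^sub>i\<close> by \<open>g i\<close>.\<close>

definition insertion :: "('k::zero \<Rightarrow> 'r::comm_semiring_1) \<Rightarrow> (nat \<Rightarrow> 'r) \<Rightarrow> 'k mpoly \<Rightarrow> 'r" where
  "insertion h g p =
     (\<Sum>e\<in>Poly_Mapping.keys p. h (Poly_Mapping.lookup p e) *
        (\<Prod>i\<in>Poly_Mapping.keys e. g i ^ Poly_Mapping.lookup e i))"

definition mpoly_eval :: "(nat \<Rightarrow> 'k::comm_semiring_1) \<Rightarrow> 'k mpoly \<Rightarrow> 'k" where
  "mpoly_eval a p = insertion (\<lambda>c. c) a p"

definition mpoly_subst :: "(nat \<Rightarrow> 'k::comm_semiring_1 mpoly) \<Rightarrow> 'k mpoly \<Rightarrow> 'k mpoly" where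
  "mpoly_subst f p = insertion mconst f p"

text \<open>The space \<open>k\<^sup>n\<close>; its points are \<^const>\<open>undefined\<close> outside \<open>{..<n}\<close>.\<close>

definition affine_space :: "nat \<Rightarrow> (nat \<Rightarrow> 'k) set" where
  "affine_space n = {..<n} \<rightarrow>\<^sub>E UNIV"

definition algebraically_independent :: "nat \<Rightarrow> (nat \<Rightarrow> 'k::comm_semiring_1 mpoly) \<Rightarrow> bool" where
  "algebraically_independent m f \<longleftrightarrow> (\<forall>p \<in> poly_ring {..<m}. mpoly_subst f p = 0 \<longrightarrow> p = 0)"

inductive_set generated_subalgebra :: "'k::comm_ring_1 mpoly set \<Rightarrow> 'k mpoly set"
  for F :: "'k mpoly set" where
  gen: "p \<in> F \<Longrightarrow> p \<in> generated_subalgebra F"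
| const: "mconst c \<in> generated_subalgebra F"
| add: "p \<in> generated_subalgebra F \<Longrightarrow> q \<in> generated_subalgebra F \<Longrightarrow> p + q \<in> generated_subalgebra F"
| mult: "p \<in> generated_subalgebra F \<Longrightarrow> q \<in> generated_subalgebra F \<Longrightarrow> p * q \<in> generated_subalgebra F"

definition determined_polys ::
    "nat \<Rightarrow> nat \<Rightarrow> (nat \<Rightarrow> 'k::comm_semiring_1 mpoly) \<Rightarrow> 'k mpoly set" where
  "determined_polys n m f =
     {g \<in> poly_ring {..<n}. \<forall>a \<in> affine_space n. \<forall>b \<in> affine_space n.
        (\<forall>i<m. mpoly_eval a (f i) = mpoly_eval b (f i)) \<longrightarrow> mpoly_eval a g = mpoly_eval b g}"

definition radical_chi :: "nat \<Rightarrow> nat \<Rightarrow> 'k::comm_semiring_1 mpoly set \<Rightarrow> 'k mpoly set" where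
  "radical_chi n \<chi> P = {g \<in> poly_ring {..<n}. \<exists>\<nu>::nat. g ^ (\<chi> ^ \<nu>) \<in> P}"

definition algebraic_set :: "nat \<Rightarrow> (nat \<Rightarrow> 'k::comm_semiring_1) set \<Rightarrow> bool" where
  "algebraic_set m A \<longleftrightarrow>
     (\<exists>P \<subseteq> poly_ring {..<m}. A = {a \<in> affine_space m. \<forall>p \<in> P. mpoly_eval a p = 0})"

definition zariski_closure :: "nat \<Rightarrow> (nat \<Rightarrow> 'k::comm_semiring_1) set \<Rightarrow> (nat \<Rightarrow> 'k) set" where
  "zariski_closure m X = algebraic_set m hull X"

definition vanishing_ideal :: "nat \<Rightarrow> (nat \<Rightarrow> 'k::comm_semiring_1) set \<Rightarrow> 'k mpoly set" where
  "vanishing_ideal m A = {p \<in> poly_ring {..<m}. \<forall>a \<in> A. mpoly_eval a p = 0}"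

text \<open>For \<open>A \<noteq> {}\<close> the empty set of variables is admissible in the maximum below, because the
  vanishing ideal then contains no nonzero constant.\<close>

definition alg_dim :: "nat \<Rightarrow> (nat \<Rightarrow> 'k::comm_semiring_1) set \<Rightarrow> int" where
  "alg_dim m A =
     (if A = {} then -1
      else int (Max {card S |S. S \<subseteq> {..<m} \<and> vanishing_ideal m A \<inter> poly_ring S = {0}}))"

definition poly_range ::
    "nat \<Rightarrow> nat \<Rightarrow> (nat \<Rightarrow> 'k::comm_semiring_1 mpoly) \<Rightarrow> (nat \<Rightarrow> 'k) set" where
  "poly_range n m f = (\<lambda>a. \<lambda>i\<in>{..<m}. mpoly_eval a (f i)) ` affine_space n"

definition almost_surjective ::
    "nat \<Rightarrow> nat \<Rightarrow> (nat \<Rightarrow> 'k::comm_semiring_1 mpoly) \<Rightarrow> bool" where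
  "almost_surjective n m f \<longleftrightarrow>
     alg_dim m (zariski_closure m (affine_space m - poly_range n m f)) \<le> int m - 2"

end

theory Submission
  imports Defs "HOL-Computational_Algebra.Primes"
begin

text \<open>
  Suppose \<open>g\<close> is determined by \<open>f\<close>. By elimination of quantifiers the image of \<open>(f, g)\<close> is
  constructible, hence contains a nonempty open part of every hypersurface in which it is dense.
  It cannot contain an open subset of \<open>k\<^sup>m\<^sup>+\<^sup>1\<close>, since it is the graph of a function; so its closure is a
  hypersurface \<open>P(x, y) = 0\<close> with \<open>P\<close> irreducible, and for generic \<open>x\<close> the polynomial \<open>P(x, y)\<close> has only
  one root \<open>y\<close>. This forces \<open>P = s(x) y\<^sup>q - r(x)\<close> with \<open>q\<close> a power of the characteristic and \<open>s\<close>, \<open>r\<close> coprime.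
  An irreducible factor \<open>p\<close> of \<open>s\<close> would make \<open>f\<close> omit \<open>V(p) - V(r)\<close>, of dimension \<open>m - 1\<close>; so if \<open>f\<close> is
  almost surjective then \<open>s\<close> is constant.

  Conversely, if \<open>f\<close> is not almost surjective, then some irreducible hypersurface \<open>V(p)\<close> meets the range
  of \<open>f\<close> only in zeros of a polynomial \<open>q\<close> not divisible by \<open>p\<close>. By the Nullstellensatz \<open>p(f)\<close> divides a
  power \<open>q(f)\<^sup>N\<close>, and \<open>q(f)\<^sup>N\<^sup>+\<^sup>1 / p(f)\<close> is determined by \<open>f\<close> but no power of it lies in \<open>k[f]\<close>.

  Only hypersurfaces occur, so the Nullstellensatz for principal ideals suffices; it follows, as does
  unique factorisation, from elimination of one variable by pseudo-division.
\<close>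

section \<open>Ring homomorphisms and subrings\<close>

locale ring_hom =
  fixes h :: "'a::comm_ring_1 \<Rightarrow> 'b::comm_ring_1"
  assumes hom_one [simp]: "h 1 = 1"
    and hom_add: "h (x + y) = h x + h y"
    and hom_mult: "h (x * y) = h x * h y"
begin

lemma hom_zero [simp]: "h 0 = 0"
  using hom_add[of 0 0] by simp

lemma hom_uminus: "h (- x) = - h x"
  using hom_add[of x "- x"] by (simp add: minus_unique)

lemma hom_diff: "h (x - y) = h x - h y"
  using hom_add[of x "- y"] by (simp add: hom_uminus)

lemma hom_sum: "h (sum g I) = (\<Sum>i\<in>I. h (g i))"
  by (induction I rule: infinite_finite_induct) (auto simp: hom_add)

lemma hom_prod: "h (prod g I) = (\<Prod>i\<in>I. h (g i))"
  by (induction I rule: infinite_finite_induct) (auto simp: hom_mult)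

lemma hom_power: "h (x ^ n) = h x ^ n"
  by (induction n) (auto simp: hom_mult)

lemma map_poly_hom: "ring_hom (map_poly h)"
proof
  show "map_poly h 1 = 1"
    by simp
  show "map_poly h (p + q) = map_poly h p + map_poly h q" for p q
    by (rule poly_eqI) (simp add: coeff_map_poly hom_add)
  show "map_poly h (p * q) = map_poly h p * map_poly h q" for p q
    by (rule poly_eqI) (simp add: coeff_map_poly coeff_mult hom_sum hom_mult)
qed

lemma poly_map_poly: "poly (map_poly h p) (h x) = h (poly p x)"
  by (induction p) (auto simp: map_poly_pCons hom_add hom_mult)

end

text \<open>Subrings are carrier sets because the rings \<open>poly_ring X\<close> for different X
  share one type, and the inductions on variables pass from one of them to another.\<close>

locale subring =
  fixes A :: "'a::comm_ring_1 set"
  assumes zero_closed [simp]: "0 \<in> A"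
    and one_closed [simp]: "1 \<in> A"
    and add_closed: "x \<in> A \<Longrightarrow> y \<in> A \<Longrightarrow> x + y \<in> A"
    and uminus_closed: "x \<in> A \<Longrightarrow> - x \<in> A"
    and mult_closed: "x \<in> A \<Longrightarrow> y \<in> A \<Longrightarrow> x * y \<in> A"
begin

lemma diff_closed: "x \<in> A \<Longrightarrow> y \<in> A \<Longrightarrow> x - y \<in> A"
  using add_closed[of x "- y"] uminus_closed[of y] by simp

lemma sum_closed: "(\<And>i. i \<in> I \<Longrightarrow> g i \<in> A) \<Longrightarrow> sum g I \<in> A"
  by (induction I rule: infinite_finite_induct) (auto intro: add_closed)

lemma prod_closed: "(\<And>i. i \<in> I \<Longrightarrow> g i \<in> A) \<Longrightarrow> prod g I \<in> A"
  by (induction I rule: infinite_finite_induct) (auto intro: mult_closed)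

lemma power_closed: "x \<in> A \<Longrightarrow> x ^ n \<in> A"
  by (induction n) (auto intro: mult_closed)

lemma insertion_closed:
  assumes "\<And>c. h c \<in> A" and "\<And>i. i \<in> X \<Longrightarrow> g i \<in> A" and "p \<in> poly_ring X"
  shows "insertion h g p \<in> A"
  using assms unfolding insertion_def poly_ring_def
  by (intro sum_closed mult_closed prod_closed power_closed) auto

end

definition polys_over :: "'a::zero set \<Rightarrow> 'a poly set" where
  "polys_over A = {p. \<forall>i. coeff p i \<in> A}"

lemma polys_overD: "p \<in> polys_over A \<Longrightarrow> coeff p i \<in> A"
  by (simp add: polys_over_def)

lemma (in subring) subring_polys_over: "subring (polys_over A)"
  by unfold_locales
    (auto simp: polys_over_def coeff_mult coeff_1 intro: add_closed uminus_closed sum_closed mult_closed)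

lemma (in subring) monom_in_polys_over: "c \<in> A \<Longrightarrow> monom c n \<in> polys_over A"
  by (auto simp: polys_over_def coeff_monom)

lemma (in subring) const_in_polys_over: "c \<in> A \<Longrightarrow> [:c:] \<in> polys_over A"
  by (auto simp: polys_over_def coeff_pCons split: nat.splits)

lemma (in subring) poly_closed:
  assumes "p \<in> polys_over A" "x \<in> A"
  shows "poly p x \<in> A"
  using assms by (auto simp: poly_altdef polys_over_def intro!: sum_closed mult_closed power_closed)

lemma (in subring) smult_in_polys_over: "c \<in> A \<Longrightarrow> p \<in> polys_over A \<Longrightarrow> smult c p \<in> polys_over A"
  by (auto simp: polys_over_def intro: mult_closed)

section \<open>Multivariate polynomials\<close>

definition mvar :: "nat \<Rightarrow> 'k::zero_neq_one mpoly" where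
  "mvar i = Poly_Mapping.single (Poly_Mapping.single i 1) 1"

text \<open>Exponents outside the support contribute \<open>h 0 = 0\<close>. Over a common superset,
  values at different polynomials can be compared term by term.\<close>

lemma insertion_superset:
  assumes "finite E" "Poly_Mapping.keys p \<subseteq> E" "h 0 = 0"
  shows "insertion h g p = (\<Sum>e\<in>E. h (Poly_Mapping.lookup p e) *
     (\<Prod>i\<in>Poly_Mapping.keys e. g i ^ Poly_Mapping.lookup e i))"
  unfolding insertion_def
  by (rule sum.mono_neutral_left) (use assms in \<open>auto simp: in_keys_iff\<close>)

text \<open>Over the union of both supports the extra factors are powers with exponent 0, and there
  the exponents add.\<close>

lemma monomial_add:
  fixes g :: "nat \<Rightarrow> 'r::comm_semiring_1"
  shows "(\<Prod>i\<in>Poly_Mapping.keys (e + e'). g i ^ Poly_Mapping.lookup (e + e') i) =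
   (\<Prod>i\<in>Poly_Mapping.keys e. g i ^ Poly_Mapping.lookup e i) *
   (\<Prod>i\<in>Poly_Mapping.keys e'. g i ^ Poly_Mapping.lookup e' i)"
proof -
  define E where "E = Poly_Mapping.keys e \<union> Poly_Mapping.keys e'"
  have *: "(\<Prod>i\<in>Poly_Mapping.keys d. g i ^ Poly_Mapping.lookup d i) = (\<Prod>i\<in>E. g i ^ Poly_Mapping.lookup d i)"
    if "Poly_Mapping.keys d \<subseteq> E" for d :: "nat \<Rightarrow>\<^sub>0 nat"
    by (rule prod.mono_neutral_left) (use that in \<open>auto simp: in_keys_iff E_def\<close>)
  show ?thesis
    using keys_add[of e e'] by (subst (1 2 3) *) (auto simp: E_def prod.distrib lookup_add power_add)
qed

lemma mpoly_sum_single: "p = (\<Sum>e\<in>Poly_Mapping.keys p. Poly_Mapping.single e (Poly_Mapping.lookup p e))"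
proof (rule poly_mapping_eqI)
  fix d
  have "(\<Sum>e\<in>Poly_Mapping.keys p. Poly_Mapping.lookup (Poly_Mapping.single e (Poly_Mapping.lookup p e)) d)
      = (\<Sum>e\<in>Poly_Mapping.keys p. if d = e then Poly_Mapping.lookup p e else 0)"
    by (intro sum.cong) (auto simp: lookup_single when_def)
  then show "Poly_Mapping.lookup p d =
    Poly_Mapping.lookup (\<Sum>e\<in>Poly_Mapping.keys p. Poly_Mapping.single e (Poly_Mapping.lookup p e)) d"
    by (simp add: lookup_sum sum.delta in_keys_iff)
qed

lemma insertion_single:
  "h 0 = 0 \<Longrightarrow> insertion h g (Poly_Mapping.single e c) = h c * (\<Prod>i\<in>Poly_Mapping.keys e. g i ^ Poly_Mapping.lookup e i)"
  by (subst insertion_superset[of "{e}"]) auto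

lemma mconst_hom: "ring_hom (mconst :: 'k::comm_ring_1 \<Rightarrow> _)"
  by unfold_locales (auto simp: mconst_def single_add mult_single)

context ring_hom
begin

lemma insertion_add: "insertion h g (p + q) = insertion h g p + insertion h g q"
proof -
  define E where "E = Poly_Mapping.keys p \<union> Poly_Mapping.keys q"
  show ?thesis
    using keys_add[of p q]
    by (subst (1 2 3) insertion_superset[of E])
      (auto simp: E_def lookup_add hom_add algebra_simps sum.distrib)
qed

lemma insertion_zero: "insertion h g 0 = 0"
  by (simp add: insertion_def)

lemma insertion_sum: "insertion h g (sum p I) = (\<Sum>i\<in>I. insertion h g (p i))"
  by (induction I rule: infinite_finite_induct) (auto simp: insertion_add insertion_zero)

lemma insertion_mult: "insertion h g (p * q) = insertion h g p * insertion h g q"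
proof -
  have single: "insertion h g (Poly_Mapping.single e c * Poly_Mapping.single e' c') =
     insertion h g (Poly_Mapping.single e c) * insertion h g (Poly_Mapping.single e' c')" for e e' c c'
    by (simp add: mult_single insertion_single hom_mult monomial_add algebra_simps)
  \<comment> \<open>The families are abstract because p and q occur again inside their own
    expansions by \<open>mpoly_sum_single\<close>; rewriting with these would loop.\<close>
  have "insertion h g (sum P I * sum Q J) = insertion h g (sum P I) * insertion h g (sum Q J)"
    if "\<And>i j. insertion h g (P i * Q j) = insertion h g (P i) * insertion h g (Q j)"
    for P Q :: "(nat \<Rightarrow>\<^sub>0 nat) \<Rightarrow> 'a mpoly" and I J
    by (simp add: sum_product insertion_sum that)
  from this[OF single, where I = "Poly_Mapping.keys p" and J = "Poly_Mapping.keys q",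
      of "\<lambda>e. e" "Poly_Mapping.lookup p" "\<lambda>e. e" "Poly_Mapping.lookup q"] show ?thesis
    by (simp flip: mpoly_sum_single)
qed

lemma insertion_hom: "ring_hom (insertion h g)"
proof
  show "insertion h g 1 = 1"
    using insertion_single[of h g 0 1] by simp
qed (simp_all add: insertion_add insertion_mult)

lemma insertion_mconst [simp]: "insertion h g (mconst c) = h c"
  by (simp add: mconst_def insertion_single)

lemma insertion_mvar [simp]: "insertion h g (mvar i) = g i"
  by (simp add: mvar_def insertion_single)

end

lemma mpoly_eval_hom: "ring_hom (mpoly_eval (a :: nat \<Rightarrow> 'k::comm_ring_1))"
proof -
  interpret ring_hom "\<lambda>c::'k. c" by unfold_locales auto
  show ?thesis unfolding mpoly_eval_def[abs_def] by (rule insertion_hom)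
qed

lemma mpoly_subst_hom: "ring_hom (mpoly_subst (a :: nat \<Rightarrow> 'k::comm_ring_1 mpoly))"
  unfolding mpoly_subst_def[abs_def] by (rule ring_hom.insertion_hom[OF mconst_hom])

lemma mpoly_eval_mvar [simp]: "mpoly_eval a (mvar i) = (a i :: 'k::comm_ring_1)"
  and mpoly_eval_mconst [simp]: "mpoly_eval a (mconst c) = c"
proof -
  interpret ring_hom "\<lambda>c::'k. c" by unfold_locales auto
  show "mpoly_eval a (mvar i) = a i" "mpoly_eval a (mconst c) = c"
    by (simp_all add: mpoly_eval_def)
qed

lemma mpoly_subst_mvar [simp]: "mpoly_subst f (mvar i) = (f i :: 'k::comm_ring_1 mpoly)"
  and mpoly_subst_mconst [simp]: "mpoly_subst f (mconst c) = mconst c"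
  by (simp_all add: mpoly_subst_def ring_hom.insertion_mvar[OF mconst_hom]
        ring_hom.insertion_mconst[OF mconst_hom])

lemma (in ring_hom) hom_insertion:
  "h (insertion k g p) = insertion (\<lambda>c. h (k c)) (\<lambda>i. h (g i)) p"
  by (simp add: insertion_def hom_sum hom_prod hom_mult hom_power)

lemma insertion_cong:
  assumes "p \<in> poly_ring X" "\<And>i. i \<in> X \<Longrightarrow> g i = g' i"
  shows "insertion h g p = insertion h g' p"
  unfolding insertion_def using assms
  by (intro sum.cong prod.cong arg_cong2[where f = "(*)"] refl)
    (auto simp: poly_ring_def subset_iff)

lemma mpoly_eval_cong:
  "p \<in> poly_ring X \<Longrightarrow> (\<And>i. i \<in> X \<Longrightarrow> a i = b i) \<Longrightarrow> mpoly_eval a p = mpoly_eval b p"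
  unfolding mpoly_eval_def by (rule insertion_cong)

lemma subring_poly_ring: "subring (poly_ring X :: 'k::comm_ring_1 mpoly set)"
proof
  fix p q :: "'k mpoly"
  assume p: "p \<in> poly_ring X" and q: "q \<in> poly_ring X"
  show "p + q \<in> poly_ring X"
    using p q keys_add[of p q] by (auto simp: poly_ring_def)
  show "p * q \<in> poly_ring X"
    unfolding poly_ring_def
  proof safe
    fix e i assume e: "e \<in> Poly_Mapping.keys (p * q)" "i \<in> Poly_Mapping.keys e"
    obtain d d' where "e = d + d'" "d \<in> Poly_Mapping.keys p" "d' \<in> Poly_Mapping.keys q"
      using keys_mult[of p q] e by blast
    then show "i \<in> X"
      using p q keys_add[of d d'] e by (fastforce simp: poly_ring_def)
  qed
next
  fix p :: "'k mpoly"
  assume p: "p \<in> poly_ring X"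
  have "e \<in> Poly_Mapping.keys p" if "e \<in> Poly_Mapping.keys (- p)" for e
    using that by (auto simp: in_keys_iff)
  then show "- p \<in> poly_ring X"
    using p by (auto simp: poly_ring_def)
qed (auto simp: poly_ring_def)

lemma mconst_in_poly_ring [simp]: "mconst c \<in> poly_ring X"
  by (auto simp: mconst_def poly_ring_def split: if_splits)

lemma mvar_in_poly_ring [simp]: "i \<in> X \<Longrightarrow> mvar i \<in> poly_ring X"
  by (auto simp: mvar_def poly_ring_def split: if_splits)

lemma poly_ring_mono: "X \<subseteq> Y \<Longrightarrow> poly_ring X \<subseteq> poly_ring Y"
  by (auto simp: poly_ring_def)

lemma mpoly_subst_mvar_id [simp]: "mpoly_subst mvar p = (p :: 'k::comm_ring_1 mpoly)"
proof -
  interpret mc: ring_hom "mconst :: 'k \<Rightarrow> _" by (rule mconst_hom)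
  have single: "mconst c * (\<Prod>i\<in>Poly_Mapping.keys e. mvar i ^ Poly_Mapping.lookup e i) = Poly_Mapping.single e c"
    for e and c :: 'k
  proof -
    have pow: "(mvar i :: 'k mpoly) ^ n = Poly_Mapping.single (Poly_Mapping.single i n) 1" for i n
      by (induction n) (auto simp: mvar_def mult_single single_add[symmetric])
    have prod: "(\<Prod>i\<in>I. (mvar i :: 'k mpoly) ^ Poly_Mapping.lookup e i) =
        Poly_Mapping.single (\<Sum>i\<in>I. Poly_Mapping.single i (Poly_Mapping.lookup e i)) 1" for I
      by (induction I rule: infinite_finite_induct) (auto simp: pow mult_single)
    have "(\<Sum>i\<in>Poly_Mapping.keys e. Poly_Mapping.single i (Poly_Mapping.lookup e i)) = e"
    proof (rule poly_mapping_eqI)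
      fix d
      have "(\<Sum>i\<in>Poly_Mapping.keys e. Poly_Mapping.lookup (Poly_Mapping.single i (Poly_Mapping.lookup e i)) d)
          = (\<Sum>i\<in>Poly_Mapping.keys e. if d = i then Poly_Mapping.lookup e i else 0)"
        by (intro sum.cong) (auto simp: lookup_single when_def)
      then show "Poly_Mapping.lookup (\<Sum>i\<in>Poly_Mapping.keys e. Poly_Mapping.single i (Poly_Mapping.lookup e i)) d
        = Poly_Mapping.lookup e d"
        by (simp add: lookup_sum sum.delta in_keys_iff)
    qed
    then show ?thesis
      by (simp add: prod mconst_def mult_single)
  qed
  show ?thesis
    unfolding mpoly_subst_def insertion_def single by (rule mpoly_sum_single[symmetric])
qed

lemma mpoly_eval_subst:
  "mpoly_eval a (mpoly_subst f p) = mpoly_eval (\<lambda>i. mpoly_eval a (f i)) (p :: 'k::comm_ring_1 mpoly)"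
  unfolding mpoly_subst_def
  by (subst ring_hom.hom_insertion[OF mpoly_eval_hom]) (simp add: mpoly_eval_def[of _ p])

lemma mpoly_subst_closed:
  assumes "\<And>i. i \<in> X \<Longrightarrow> f i \<in> poly_ring Y" "p \<in> poly_ring X"
  shows "mpoly_subst f (p :: 'k::comm_ring_1 mpoly) \<in> poly_ring Y"
  unfolding mpoly_subst_def
  by (rule subring.insertion_closed[OF subring_poly_ring _ _ assms(2)]) (use assms in auto)

lemma poly_ring_finite_vars: obtains X where "finite X" "p \<in> poly_ring X"
proof
  show "finite (\<Union>e\<in>Poly_Mapping.keys p. Poly_Mapping.keys e)" by auto
  show "p \<in> poly_ring (\<Union>e\<in>Poly_Mapping.keys p. Poly_Mapping.keys e)"
    by (auto simp: poly_ring_def)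
qed

section \<open>Polynomials in one chosen variable over the polynomials in the others\<close>

definition to_poly :: "nat \<Rightarrow> 'k::comm_ring_1 mpoly \<Rightarrow> 'k mpoly poly" where
  "to_poly v = insertion (\<lambda>c. [:mconst c:]) (\<lambda>i. if i = v then [:0, 1:] else [:mvar i:])"

lemma const_mconst_hom: "ring_hom (\<lambda>c. [:mconst c :: 'k::comm_ring_1 mpoly:])"
  by unfold_locales (auto simp: ring_hom.hom_add[OF mconst_hom] ring_hom.hom_mult[OF mconst_hom]
     ring_hom.hom_one[OF mconst_hom] one_pCons)

lemma to_poly_hom: "ring_hom (to_poly v)"
  unfolding to_poly_def by (rule ring_hom.insertion_hom[OF const_mconst_hom])

lemma poly_hom: "ring_hom (\<lambda>p. poly p x)"
  by unfold_locales auto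

lemma poly_to_poly [simp]: "poly (to_poly v p) (mvar v) = p"
proof -
  have "poly (to_poly v p) (mvar v) = mpoly_subst mvar p"
    unfolding to_poly_def mpoly_subst_def
    by (subst ring_hom.hom_insertion[OF poly_hom]) (auto simp: if_distrib if_distribR cong: if_cong intro!: arg_cong3[where f = insertion])
  then show ?thesis by simp
qed

lemma to_poly_eq_0_iff [simp]: "to_poly v p = 0 \<longleftrightarrow> p = 0"
  using poly_to_poly[of v p] ring_hom.hom_zero[OF to_poly_hom] by fastforce

lemma to_poly_const: "p \<in> poly_ring X \<Longrightarrow> v \<notin> X \<Longrightarrow> to_poly v p = [:p:]"
proof -
  assume p: "p \<in> poly_ring X" "v \<notin> X"
  have c: "ring_hom (\<lambda>x. [:x :: 'a mpoly:])"
    by unfold_locales (auto simp: one_pCons)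
  have "to_poly v p = insertion (\<lambda>c. [:mconst c:]) (\<lambda>i. [:mvar i:]) p"
    unfolding to_poly_def by (rule insertion_cong[OF p(1)]) (use p in auto)
  also have "\<dots> = [:mpoly_subst mvar p:]"
    unfolding mpoly_subst_def by (subst ring_hom.hom_insertion[OF c]) simp
  finally show ?thesis by simp
qed

lemma to_poly_closed:
  assumes "p \<in> poly_ring X"
  shows "to_poly v p \<in> polys_over (poly_ring (X - {v}))"
  unfolding to_poly_def
  by (rule subring.insertion_closed[OF subring.subring_polys_over[OF subring_poly_ring] _ _ assms])
    (auto simp: polys_over_def coeff_pCons subring.zero_closed[OF subring_poly_ring]
      subring.one_closed[OF subring_poly_ring] split: nat.splits)

text \<open>The coefficients of P do not contain x_v, so \<open>to_poly v\<close> makes them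
  constants; what remains is the composition of P with the identity polynomial
  \<open>[:0, 1:]\<close>.\<close>

lemma to_poly_poly:
  assumes "P \<in> polys_over (poly_ring X)" "v \<notin> X"
  shows "to_poly v (poly P (mvar v)) = P"
proof -
  have "to_poly v (poly P (mvar v)) = poly (map_poly (to_poly v) P) (to_poly v (mvar v))"
    by (rule ring_hom.poly_map_poly[OF to_poly_hom, symmetric])
  also have "map_poly (to_poly v) P = map_poly (\<lambda>c. [:c:]) P"
    by (rule map_poly_cong) (use assms in \<open>auto simp: polys_over_def coeffs_def intro!: to_poly_const split: if_splits\<close>)
  also have "to_poly v (mvar v) = [:0, 1:]"
    unfolding to_poly_def by (simp add: ring_hom.insertion_mvar[OF const_mconst_hom])
  also have "poly (map_poly (\<lambda>c. [:c:]) P) [:0, 1:] = P"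
    by (simp flip: pcompose_altdef)
  finally show ?thesis .
qed

text \<open>Both sides evaluate p by the same values of the variables. Through this identity, facts
  about roots of univariate polynomials become facts about zeros on a line parallel to the x_v
  axis.\<close>

lemma mpoly_eval_upd:
  "mpoly_eval (a(v := t)) p = poly (map_poly (mpoly_eval a) (to_poly v p)) t"
proof -
  interpret ev: ring_hom "mpoly_eval a" by (rule mpoly_eval_hom)
  have c: "ring_hom (\<lambda>P. poly (map_poly (mpoly_eval a) P) t)"
    using ring_hom.hom_add[OF ev.map_poly_hom] ring_hom.hom_mult[OF ev.map_poly_hom]
    by unfold_locales auto
  have "poly (map_poly (mpoly_eval a) (to_poly v p)) t =
     insertion (\<lambda>c. c) (\<lambda>i. if i = v then t else a i) p"
    unfolding to_poly_def
    by (subst ring_hom.hom_insertion[OF c])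
      (auto simp: if_distrib if_distribR map_poly_pCons cong: if_cong intro!: arg_cong3[where f = insertion])
  then show ?thesis
    by (simp add: mpoly_eval_def fun_upd_def)
qed

section \<open>Degrees and factorisation\<close>

definition mdeg :: "nat \<Rightarrow> 'k::comm_ring_1 mpoly \<Rightarrow> nat" where
  "mdeg v p = degree (to_poly v p)"

lemma mdeg_mult:
  fixes p q :: "'k::idom mpoly"
  assumes "p \<noteq> 0" "q \<noteq> 0"
  shows "mdeg v (p * q) = mdeg v p + mdeg v q"
  using assms by (simp add: mdeg_def ring_hom.hom_mult[OF to_poly_hom] degree_mult_eq)

text \<open>If the degree in x_v is 0, then p is the constant coefficient of
  \<open>to_poly v p\<close>, which avoids x_v. Since degrees add under products, this form makes
  divisors easy to control.\<close>

lemma in_poly_ring_iff: "p \<in> poly_ring X \<longleftrightarrow> (\<forall>v. v \<notin> X \<longrightarrow> mdeg v p = 0)"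
proof
  assume *: "\<forall>v. v \<notin> X \<longrightarrow> mdeg v p = 0"
  have "p \<in> poly_ring (- {v})" if v: "v \<notin> X" for v
  proof -
    from v * have "degree (to_poly v p) = 0"
      by (simp add: mdeg_def)
    then obtain c where c: "to_poly v p = [:c:]"
      by (rule degree_eq_zeroE)
    have "p \<in> poly_ring UNIV"
      by (simp add: poly_ring_def)
    from to_poly_closed[OF this, of v] have "coeff (to_poly v p) 0 \<in> poly_ring (- {v})"
      by (simp add: polys_over_def Compl_eq_Diff_UNIV)
    then show ?thesis
      using poly_to_poly[of v p] by (simp add: c)
  qed
  then show "p \<in> poly_ring X"
    unfolding poly_ring_def by blast
qed (auto simp: mdeg_def to_poly_const)

lemma mdeg_eq_0: "p \<in> poly_ring X \<Longrightarrow> v \<notin> X \<Longrightarrow> mdeg v p = 0"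
  by (auto simp: in_poly_ring_iff)

lemma poly_ring_Diff: "p \<in> poly_ring X \<Longrightarrow> mdeg v p = 0 \<Longrightarrow> p \<in> poly_ring (X - {v})"
  by (auto simp: in_poly_ring_iff)

lemma poly_ring_dvd_closed:
  fixes p q :: "'k::idom mpoly"
  assumes "p \<in> poly_ring X" "q dvd p" "p \<noteq> 0"
  shows "q \<in> poly_ring X"
proof -
  obtain r where "p = q * r" using assms by blast
  with assms show ?thesis
    by (auto simp: in_poly_ring_iff mdeg_mult)
qed

lemma poly_ring_empty: "p \<in> poly_ring {} \<Longrightarrow> \<exists>c. p = mconst c"
proof
  assume "p \<in> poly_ring {}"
  then have "Poly_Mapping.keys p \<subseteq> {0}"
    by (auto simp: poly_ring_def)
  then show "p = mconst (Poly_Mapping.lookup p 0)"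
    by (intro poly_mapping_eqI) (auto simp: mconst_def lookup_single when_def in_keys_iff subset_iff)
qed

lemma unit_in_poly_ring: "p dvd (1 :: 'k::idom mpoly) \<Longrightarrow> p \<in> poly_ring X"
  by (rule poly_ring_dvd_closed[of 1]) (auto simp: subring.one_closed[OF subring_poly_ring])

lemma mconst_unit: "c \<noteq> 0 \<Longrightarrow> mconst (c :: 'k::field) dvd 1"
proof
  assume "c \<noteq> 0"
  then show "1 = mconst c * mconst (inverse c)"
    using ring_hom.hom_mult[OF mconst_hom, of c "inverse c"] ring_hom.hom_one[OF mconst_hom, where ?'a='k]
    by simp
qed

lemma mconst_eq_0_iff [simp]: "mconst c = 0 \<longleftrightarrow> c = 0"
  unfolding mconst_def by (metis lookup_single_eq lookup_zero single_zero)

text \<open>Both facts come from induction on the same measure. The induction rule stands in for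
  writing p as a product of irreducible polynomials.\<close>

lemma ex_irreducible_divisor:
  fixes p :: "'k::field mpoly"
  assumes "p \<noteq> 0"
  shows "\<not> p dvd 1 \<Longrightarrow> \<exists>q. irreducible q \<and> q dvd p"
    and mpoly_factor_induct [consumes 1, case_names unit mult]: "(\<And>u. u dvd 1 \<Longrightarrow> P u) \<Longrightarrow>
      (\<And>q r. irreducible q \<Longrightarrow> r \<noteq> 0 \<Longrightarrow> P r \<Longrightarrow> P (q * r)) \<Longrightarrow> P p"
proof -
  obtain X where X: "finite X" "p \<in> poly_ring X"
    by (rule poly_ring_finite_vars)
  \<comment> \<open>The sum of the degrees in the single variables: additive on products, and
    positive on nonzero nonunits because a polynomial of measure 0 is constant.\<close>
  define s where "s p = (\<Sum>v\<in>X. mdeg v p)" for p :: "'k mpoly"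
  have s_mult: "s (p * q) = s p + s q" if "p \<noteq> 0" "q \<noteq> 0" for p q :: "'k mpoly"
    using that by (simp add: s_def mdeg_mult sum.distrib)
  have s_pos: "s p > 0" if "p \<noteq> 0" "p \<in> poly_ring X" "\<not> p dvd 1" for p :: "'k mpoly"
  proof (rule ccontr)
    assume "\<not> s p > 0"
    then have "p \<in> poly_ring {}"
      using X that by (auto simp: s_def in_poly_ring_iff)
    then obtain c where "p = mconst c"
      using poly_ring_empty by blast
    then show False
      using that mconst_unit[of c] by auto
  qed
  have ex: "\<exists>q. irreducible q \<and> q dvd p" if "p \<noteq> 0" "p \<in> poly_ring X" "\<not> p dvd 1" for p :: "'k mpoly"
    using that
  proof (induction "s p" arbitrary: p rule: less_induct)
    case less
    show ?case
    proof (cases "irreducible p")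
      case False
      then obtain a b where ab: "p = a * b" "\<not> a dvd 1" "\<not> b dvd 1"
        using less.prems by (auto simp: irreducible_def)
      with less.prems have nz: "a \<noteq> 0" "b \<noteq> 0"
        by auto
      have "a \<in> poly_ring X" "b \<in> poly_ring X"
        using less.prems ab by (auto intro: poly_ring_dvd_closed)
      with ab nz s_mult[of a b] s_pos[of b] less.hyps[of a] show ?thesis
        by auto
    qed auto
  qed
  show "\<exists>q. irreducible q \<and> q dvd p" if "\<not> p dvd 1"
    using that ex assms X by blast
  assume unit: "\<And>u. u dvd 1 \<Longrightarrow> P u"
    and mult: "\<And>q r. irreducible q \<Longrightarrow> r \<noteq> 0 \<Longrightarrow> P r \<Longrightarrow> P (q * r)"
  have "P p" if "p \<noteq> 0" "p \<in> poly_ring X" for p :: "'k mpoly"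
    using that
  proof (induction "s p" arbitrary: p rule: less_induct)
    case less
    show ?case
    proof (cases "p dvd 1")
      case False
      then obtain q r where q: "irreducible q" "p = q * r"
        using ex[of p] less.prems by auto
      with less.prems have r: "q \<noteq> 0" "r \<noteq> 0" "q \<in> poly_ring X" "r \<in> poly_ring X"
        by (auto intro: poly_ring_dvd_closed)
      have "s r < s p"
        using q r s_mult[of q r] s_pos[of q] by (auto simp: irreducible_def)
      then show ?thesis
        using mult[OF q(1) r(2)] less.hyps r q by simp
    qed (rule unit)
  qed
  then show "P p"
    using assms X by blast
qed

section \<open>Pseudo-division\<close>

lemma lead_reduction:
  fixes a b :: "'a::idom poly"
  assumes "a \<noteq> 0" "b \<noteq> 0" "degree b \<le> degree a"
  defines "a' \<equiv> smult (lead_coeff b) a - monom (lead_coeff a) (degree a - degree b) * b"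
  shows "a' = 0 \<or> degree a' < degree a"
proof (rule eq_zero_or_degree_less)
  have "degree (monom (lead_coeff a) (degree a - degree b) * b) \<le> degree a"
    using assms degree_mult_le[of "monom (lead_coeff a) (degree a - degree b)" b]
    by (simp add: degree_monom_eq)
  then show "degree a' \<le> degree a"
    unfolding a'_def by (intro degree_diff_le) auto
  have "coeff (monom (lead_coeff a) (degree a - degree b) * b) (degree a) = lead_coeff a * lead_coeff b"
    using assms by (simp add: coeff_monom_mult)
  then show "coeff a' (degree a) = 0"
    unfolding a'_def by simp
qed

text \<open>Leading-term reduction is repeated; each round costs one more factor
  \<open>lead_coeff b\<close>, and all coefficients stay in A.\<close>

lemma pseudo_division:
  fixes a b :: "'a::idom poly"
  assumes A: "subring A" and "a \<in> polys_over A" "b \<in> polys_over A" "b \<noteq> 0"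
  shows "\<exists>k q r. smult (lead_coeff b ^ k) a = b * q + r \<and> q \<in> polys_over A \<and> r \<in> polys_over A
     \<and> (r = 0 \<or> degree r < degree b)"
  using assms(2)
proof (induction "degree a" arbitrary: a rule: less_induct)
  case less
  interpret subring A by fact
  interpret P: subring "polys_over A" by (rule subring_polys_over)
  show ?case
  proof (cases "a = 0 \<or> degree a < degree b")
    case True
    then show ?thesis
      using less.prems by (intro exI[of _ 0] exI[of _ 0] exI[of _ a]) auto
  next
    case False
    define m where "m = monom (lead_coeff a) (degree a - degree b)"
    define a' where "a' = smult (lead_coeff b) a - m * b"
    have m: "m \<in> polys_over A"
      unfolding m_def using less.prems by (intro monom_in_polys_over) (auto simp: polys_over_def)
    have a': "a' \<in> polys_over A"
      unfolding a'_def using less.prems assms m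
      by (intro P.diff_closed P.mult_closed smult_in_polys_over) (auto simp: polys_over_def)
    have "a' = 0 \<or> degree a' < degree a"
      unfolding a'_def m_def using False assms by (intro lead_reduction) auto
    moreover have ?thesis if "a' = 0"
      using that m by (intro exI[of _ 1] exI[of _ m] exI[of _ 0]) (auto simp: a'_def)
    moreover have ?thesis if smaller: "degree a' < degree a"
    proof -
      obtain k q r where IH: "smult (lead_coeff b ^ k) a' = b * q + r" "q \<in> polys_over A" "r \<in> polys_over A"
        "r = 0 \<or> degree r < degree b"
        using less.hyps[OF smaller a'] by blast
      have "smult (lead_coeff b ^ Suc k) a = smult (lead_coeff b ^ k) a' + smult (lead_coeff b ^ k) (m * b)"
        by (simp add: a'_def smult_diff_right mult.commute)
      also have "\<dots> = b * (q + smult (lead_coeff b ^ k) m) + r"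
        by (simp add: IH algebra_simps)
      finally have "smult (lead_coeff b ^ Suc k) a = b * (q + smult (lead_coeff b ^ k) m) + r" .
      moreover have "q + smult (lead_coeff b ^ k) m \<in> polys_over A"
        using IH m polys_overD[OF assms(3)]
        by (intro P.add_closed smult_in_polys_over power_closed)
      ultimately show ?thesis
        using IH by blast
    qed
    ultimately show ?thesis by blast
  qed
qed

text \<open>In the ideal generated by p and q, let c be nonzero of least degree; the
  pseudo-remainders of p and q by c lie in the ideal and must be 0. With denominators cleared by
  \<alpha> and \<beta>, this is Bezout over the fraction field of A.\<close>

lemma pseudo_gcd:
  fixes p q :: "'a::idom poly"
  assumes A: "subring A" and p: "p \<in> polys_over A" "p \<noteq> 0" and q: "q \<in> polys_over A"
  shows "\<exists>c u w h h' \<alpha> \<beta>. {c, u, w, h, h'} \<subseteq> polys_over A \<and> {\<alpha>, \<beta>} \<subseteq> A - {0} \<and> c \<noteq> 0 \<and>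
     c = u * p + w * q \<and> smult \<alpha> p = c * h \<and> smult \<beta> q = c * h'"
proof -
  interpret subring A by fact
  interpret P: subring "polys_over A" by (rule subring_polys_over)
  define I where "I = {c. \<exists>u\<in>polys_over A. \<exists>w\<in>polys_over A. c = u * p + w * q}"
  have mem_I: "u * p + w * q \<in> I" if "u \<in> polys_over A" "w \<in> polys_over A" for u w
    unfolding I_def using that by blast
  have pI: "p \<in> I" and qI: "q \<in> I"
    using mem_I[of 1 0] mem_I[of 0 1] by simp_all
  obtain c where c: "c \<in> I" "c \<noteq> 0" and min: "\<And>d. d \<in> I \<Longrightarrow> d \<noteq> 0 \<Longrightarrow> degree c \<le> degree d"
    using ex_has_least_nat[of "\<lambda>c. c \<in> I \<and> c \<noteq> 0" p degree] pI p by blast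
  from c obtain u w where uw: "u \<in> polys_over A" "w \<in> polys_over A" "c = u * p + w * q"
    unfolding I_def by blast
  have cA: "c \<in> polys_over A"
    unfolding uw using uw p q by (intro P.add_closed P.mult_closed)
  have div: "\<exists>\<alpha> h. \<alpha> \<in> A - {0} \<and> h \<in> polys_over A \<and> smult \<alpha> d = c * h"
    if d: "d \<in> I" "d \<in> polys_over A" for d
  proof -
    obtain k h r where r: "smult (lead_coeff c ^ k) d = c * h + r" "h \<in> polys_over A" "r \<in> polys_over A"
      "r = 0 \<or> degree r < degree c"
      using pseudo_division[OF A d(2) cA c(2)] by blast
    define l where "l = lead_coeff c ^ k"
    have l: "l \<in> A - {0}"
      unfolding l_def using cA c by (auto intro!: power_closed simp: polys_over_def)
    from d obtain u' w' where uw': "u' \<in> polys_over A" "w' \<in> polys_over A" "d = u' * p + w' * q"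
      unfolding I_def by blast
    have "r = smult l d - c * h"
      using r by (simp add: l_def)
    also have "\<dots> = (smult l u' - u * h) * p + (smult l w' - w * h) * q"
      unfolding uw uw' by (simp add: algebra_simps smult_add_right)
    also have "\<dots> \<in> I"
      using uw uw' r l by (intro mem_I P.diff_closed P.mult_closed smult_in_polys_over) auto
    finally have "r \<in> I" .
    with min[of r] r(4) have "r = 0"
      by (metis not_le)
    with r l show ?thesis
      unfolding l_def by auto
  qed
  from div[OF pI p(1)] obtain \<alpha> h where "\<alpha> \<in> A - {0}" "h \<in> polys_over A" "smult \<alpha> p = c * h"
    by blast
  moreover from div[OF qI q] obtain \<beta> h' where "\<beta> \<in> A - {0}" "h' \<in> polys_over A" "smult \<beta> q = c * h'"
    by blast
  ultimately have "{c, u, w, h, h'} \<subseteq> polys_over A \<and> {\<alpha>, \<beta>} \<subseteq> A - {0} \<and> c \<noteq> 0 \<and>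
     c = u * p + w * q \<and> smult \<alpha> p = c * h \<and> smult \<beta> q = c * h'"
    using uw(1,2) cA c(2) by (intro conjI uw(3)) auto
  then show ?thesis by (intro exI)
qed

lemma mpoly_pseudo_gcd:
  fixes p q :: "'k::idom mpoly"
  assumes v: "v \<in> X" and p: "p \<in> poly_ring X" "p \<noteq> 0" and q: "q \<in> poly_ring X"
  obtains c u w h h' \<alpha> \<beta> where "{c, u, w, h, h'} \<subseteq> poly_ring X" "{\<alpha>, \<beta>} \<subseteq> poly_ring (X - {v}) - {0}"
     "c \<noteq> 0" "c = u * p + w * q" "\<alpha> * p = c * h" "\<beta> * q = c * h'"
proof -
  let ?A = "poly_ring (X - {v}) :: 'k mpoly set"
  let ?e = "\<lambda>p. poly p (mvar v) :: 'k mpoly"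
  have "to_poly v p \<noteq> 0"
    using p by simp
  from pseudo_gcd[OF subring_poly_ring to_poly_closed[OF p(1)] this to_poly_closed[OF q]]
  obtain c u w h h' \<alpha> \<beta> where *: "{c, u, w, h, h'} \<subseteq> polys_over ?A" "{\<alpha>, \<beta>} \<subseteq> ?A - {0}" "c \<noteq> 0"
     "c = u * to_poly v p + w * to_poly v q" "smult \<alpha> (to_poly v p) = c * h" "smult \<beta> (to_poly v q) = c * h'"
    by (elim exE conjE) (rule that)
  have "?e f \<in> poly_ring X" if "f \<in> polys_over ?A" for f
    by (rule subring.poly_closed[OF subring_poly_ring])
      (use that v poly_ring_mono[of "X - {v}" X] in \<open>auto simp: polys_over_def\<close>)
  with *(1) have "{?e c, ?e u, ?e w, ?e h, ?e h'} \<subseteq> poly_ring X"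
    unfolding insert_subset by blast
  moreover note *(2)
  \<comment> \<open>Substituting \<open>mvar v\<close> loses nothing, since \<open>to_poly v\<close>
    recovers c.\<close>
  moreover have "?e c \<noteq> 0"
    using *(1,3) to_poly_poly[of c "X - {v}" v] ring_hom.hom_zero[OF to_poly_hom] by fastforce
  moreover have "?e c = ?e u * p + ?e w * q" "\<alpha> * p = ?e c * ?e h" "\<beta> * q = ?e c * ?e h'"
    using arg_cong[OF *(4), of ?e] arg_cong[OF *(5), of ?e] arg_cong[OF *(6), of ?e] by simp_all
  ultimately show ?thesis
    by (rule that)
qed

section \<open>Irreducible polynomials are prime\<close>

text \<open>Primality is relative to R so that it can be proved by induction on the set of
  variables. Divisibility is that of the whole type; by \<open>poly_ring_dvd_closed\<close> the
  quotient of a nonzero element of \<open>poly_ring X\<close> stays there.\<close>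

definition prime_in :: "'a::comm_semiring_1 set \<Rightarrow> 'a \<Rightarrow> bool" where
  "prime_in R p \<longleftrightarrow> (\<forall>a\<in>R. \<forall>b\<in>R. p dvd a * b \<longrightarrow> p dvd a \<or> p dvd b)"

text \<open>Gauss's lemma: if c divides y * z, it divides the product of the leading coefficients,
  hence one of them; that leading term is dropped and the sum of the degrees decreases.\<close>

lemma const_prime_in_polys_over:
  fixes c :: "'a::idom"
  assumes A: "subring A" and c: "prime_in A c"
  shows "prime_in (polys_over A) [:c:]"
proof -
  interpret subring A by fact
  interpret P: subring "polys_over A" by (rule subring_polys_over)
  have lead: "\<exists>y'\<in>polys_over A. [:c:] dvd y - y' \<and> (y' = 0 \<or> degree y' < degree y)"
    if y: "y \<in> polys_over A" "c dvd lead_coeff y" for y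
  proof
    let ?m = "monom (lead_coeff y) (degree y)"
    show "y - ?m \<in> polys_over A"
      using y by (intro P.diff_closed monom_in_polys_over) (auto simp: polys_over_def)
    have "[:c:] dvd ?m"
      using y by (auto simp: const_poly_dvd_iff coeff_monom)
    moreover have "y - ?m = 0 \<or> degree (y - ?m) < degree y"
      by (rule eq_zero_or_degree_less) (auto intro!: degree_diff_le degree_monom_le)
    ultimately show "[:c:] dvd y - (y - ?m) \<and> (y - ?m = 0 \<or> degree (y - ?m) < degree y)"
      by simp
  qed
  have "[:c:] dvd y \<or> [:c:] dvd z"
    if "y \<in> polys_over A" "z \<in> polys_over A" "[:c:] dvd y * z" for y z
    using that
  proof (induction "degree y + degree z" arbitrary: y z rule: less_induct)
    case less
    have "c dvd coeff (y * z) (degree y + degree z)"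
      using less.prems(3) by (simp add: const_poly_dvd_iff)
    then have "c dvd lead_coeff y \<or> c dvd lead_coeff z"
      using c less.prems by (auto simp: prime_in_def polys_over_def coeff_mult_degree_sum)
    then show ?case
    proof
      assume "c dvd lead_coeff y"
      from lead[OF less.prems(1) this] obtain y' where
        y': "y' \<in> polys_over A" "[:c:] dvd y - y'" "y' = 0 \<or> degree y' < degree y" by blast
      have "[:c:] dvd y * z - (y - y') * z"
        using y' less.prems by (intro dvd_diff) auto
      then have "[:c:] dvd y' * z"
        by (simp add: algebra_simps)
      then have "[:c:] dvd y' \<or> [:c:] dvd z"
        using y' less.prems less.hyps[of y' z] by auto
      then show ?thesis
        using y' dvd_add[of "[:c:]" "y - y'" y'] by auto
    next
      assume "c dvd lead_coeff z"
      from lead[OF less.prems(2) this] obtain z' where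
        z': "z' \<in> polys_over A" "[:c:] dvd z - z'" "z' = 0 \<or> degree z' < degree z" by blast
      have "[:c:] dvd y * z - y * (z - z')"
        using z' less.prems by (intro dvd_diff) auto
      then have "[:c:] dvd y * z'"
        by (simp add: algebra_simps)
      then have "[:c:] dvd y \<or> [:c:] dvd z'"
        using z' less.prems less.hyps[of y z'] by auto
      then show ?thesis
        using z' dvd_add[of "[:c:]" "z - z'" z'] by auto
    qed
  qed
  then show ?thesis
    by (auto simp: prime_in_def)
qed

lemma dvd_iff_const_dvd_to_poly:
  assumes "c \<in> poly_ring X" "v \<notin> X"
  shows "c dvd p \<longleftrightarrow> [:c:] dvd to_poly v p"
proof
  assume "c dvd p"
  then obtain r where "p = c * r" by blast
  then show "[:c:] dvd to_poly v p"
    by (simp only: ring_hom.hom_mult[OF to_poly_hom] to_poly_const[OF assms] dvd_triv_left)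
next
  assume "[:c:] dvd to_poly v p"
  then obtain r where "to_poly v p = [:c:] * r" by blast
  then have "p = c * poly r (mvar v)"
    using poly_to_poly[of v p] by simp
  then show "c dvd p" by simp
qed

lemma prime_in_insert:
  fixes c :: "'k::idom mpoly"
  assumes "c \<in> poly_ring X" "v \<notin> X" "prime_in (poly_ring X) c"
  shows "prime_in (poly_ring (insert v X)) c"
proof -
  have "to_poly v a \<in> polys_over (poly_ring X)" if "a \<in> poly_ring (insert v X)" for a :: "'k mpoly"
    using to_poly_closed[OF that, of v] assms by simp
  with const_prime_in_polys_over[OF subring_poly_ring assms(3)] show ?thesis
    by (simp add: prime_in_def dvd_iff_const_dvd_to_poly[OF assms(1,2)] ring_hom.hom_mult[OF to_poly_hom])
qed

text \<open>Each irreducible factor of \<alpha> is prime in \<open>poly_ring Y\<close>, so it can be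
  cancelled from y or from z; \<gamma> and \<delta> collect the factors cancelled on either
  side.\<close>

lemma split_product:
  fixes \<alpha> x y z :: "'k::field mpoly"
  assumes pr: "\<And>q :: 'k mpoly. irreducible q \<Longrightarrow> q \<in> poly_ring X \<Longrightarrow> prime_in (poly_ring Y) q"
    and "\<alpha> \<noteq> 0" "\<alpha> \<in> poly_ring X" "\<alpha> * x = y * z" "y \<in> poly_ring Y" "z \<in> poly_ring Y" "x \<noteq> 0"
  shows "\<exists>\<gamma> \<delta> y' z'. \<alpha> = \<gamma> * \<delta> \<and> y = \<gamma> * y' \<and> z = \<delta> * z' \<and> x = y' * z'"
proof -
  \<comment> \<open>A unit is charged entirely to the first factor: \<gamma> = u and \<delta> =
    1.\<close>
  have u: "\<exists>\<gamma> \<delta> y' z'. u = \<gamma> * \<delta> \<and> y = \<gamma> * y' \<and> z = \<delta> * z' \<and> x = y' * z'"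
    if "u dvd 1" "u * x = y * z" for u y z :: "'k mpoly"
  proof -
    from that obtain \<beta> where \<beta>: "1 = u * \<beta>" by blast
    have "x = (u * \<beta>) * x"
      by (simp flip: \<beta>)
    also have "\<dots> = (y * \<beta>) * z"
      using that(2) by (simp add: ac_simps)
    finally have "x = (y * \<beta>) * z" .
    moreover have "y = u * (y * \<beta>)"
      using \<beta> by (simp add: mult.left_commute)
    ultimately show ?thesis
      by (intro exI[of _ u] exI[of _ 1] exI[of _ "y * \<beta>"] exI[of _ z]) auto
  qed
  show ?thesis
    using assms(2-)
  proof (induction \<alpha> arbitrary: y z rule: mpoly_factor_induct)
    case (unit u)
    then show ?case
      using u by blast
  next
    case (mult q r)
    have nz: "q \<noteq> 0" "q * r \<noteq> 0" "y * z \<noteq> 0"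
      using mult by (auto simp: irreducible_def simp flip: mult.prems(2))
    have q: "q \<in> poly_ring X" and r: "r \<in> poly_ring X"
      using nz by (auto intro: poly_ring_dvd_closed[OF mult.prems(1)])
    have "q dvd y * z"
      by (simp flip: mult.prems(2) add: mult.assoc)
    then consider "q dvd y" | "q dvd z"
      using pr[OF mult.hyps(1) q] mult by (auto simp: prime_in_def)
    then show ?case
    proof cases
      case 1
      then obtain y1 where y1: "y = q * y1" by blast
      then have "y1 \<in> poly_ring Y"
        using mult nz by (auto intro: poly_ring_dvd_closed[of y])
      moreover have "r * x = y1 * z"
        using mult.prems(2) nz(1) by (simp add: y1 mult.assoc)
      ultimately obtain \<gamma> \<delta> y' z' where "r = \<gamma> * \<delta>" "y1 = \<gamma> * y'" "z = \<delta> * z'" "x = y' * z'"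
        using mult.IH[OF r, of y1 z] mult by blast
      then show ?thesis
        by (intro exI[of _ "q * \<gamma>"] exI[of _ \<delta>] exI[of _ y'] exI[of _ z']) (auto simp: y1 mult.assoc)
    next
      case 2
      then obtain z1 where z1: "z = q * z1" by blast
      then have "z1 \<in> poly_ring Y"
        using mult nz by (auto intro: poly_ring_dvd_closed[of z])
      moreover have "r * x = y * z1"
        using mult.prems(2) nz(1) by (simp add: z1 mult.assoc mult.left_commute)
      ultimately obtain \<gamma> \<delta> y' z' where "r = \<gamma> * \<delta>" "y = \<gamma> * y'" "z1 = \<delta> * z'" "x = y' * z'"
        using mult.IH[OF r, of y z1] mult by blast
      then show ?thesis
        by (intro exI[of _ "\<gamma>"] exI[of _ "q * \<delta>"] exI[of _ y'] exI[of _ z']) (auto simp: z1 mult.assoc mult.left_commute)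
    qed
  qed
qed

text \<open>The factors of \<beta> are distributed over p and its cofactor w. The share \<gamma> of
  p is free of x_v, so irreducibility of p makes \<gamma> a unit, and p divides x.\<close>

lemma dvd_cancel_coefficient:
  fixes p x \<beta> :: "'k::field mpoly"
  assumes pr: "\<And>q :: 'k mpoly. irreducible q \<Longrightarrow> q \<in> poly_ring (X - {v}) \<Longrightarrow> prime_in (poly_ring X) q"
    and p: "irreducible p" "p \<in> poly_ring X" "mdeg v p > 0"
    and \<beta>: "\<beta> \<in> poly_ring (X - {v})" "\<beta> \<noteq> 0" and x: "x \<in> poly_ring X" and dvd: "p dvd \<beta> * x"
  shows "p dvd x"
proof (cases "x = 0")
  case False
  from dvd obtain w where w: "\<beta> * x = p * w" by blast
  have "\<beta> * x \<noteq> 0" "\<beta> * x \<in> poly_ring X"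
    using False \<beta> x poly_ring_mono[of "X - {v}" X] by (auto intro: subring.mult_closed[OF subring_poly_ring])
  then have "w \<in> poly_ring X"
    using w by (auto intro: poly_ring_dvd_closed)
  from split_product[OF pr \<beta>(2,1) w p(2) this False]
  obtain \<gamma> \<delta> p' w' where *: "\<beta> = \<gamma> * \<delta>" "p = \<gamma> * p'" "w = \<delta> * w'" "x = p' * w'"
    by blast
  have nz: "\<gamma> \<noteq> 0" "p' \<noteq> 0"
    using p * by (auto simp: irreducible_def)
  have "mdeg v \<gamma> = 0"
    using \<beta> * by (intro mdeg_eq_0[OF poly_ring_dvd_closed[of \<beta> "X - {v}"]]) auto
  \<comment> \<open>The whole positive degree of p in x_v sits in p'.\<close>
  then have "\<not> p' dvd 1"
    using p(3) nz mdeg_eq_0[OF unit_in_poly_ring, of p' v "{}"] by (auto simp: * mdeg_mult)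
  then have "\<gamma> dvd 1"
    using p(1) * by (auto simp: irreducible_def)
  then obtain \<gamma>1 where "1 = \<gamma> * \<gamma>1" by blast
  then have "x = (\<gamma> * \<gamma>1) * x"
    by simp
  also have "\<dots> = p * (\<gamma>1 * w')"
    by (simp add: * ac_simps)
  finally show ?thesis by simp
qed simp

text \<open>Induction on the variables. If x_v is absent from p, Gauss's lemma applies. Otherwise
  the pseudo-gcd c of p and a is, up to factors free of x_v, either associated to p or a unit;
  \<open>cancel\<close> removes these factors.\<close>

lemma irreducible_prime_in:
  fixes p :: "'k::field mpoly"
  assumes "finite X" "irreducible p" "p \<in> poly_ring X"
  shows "prime_in (poly_ring X) p"
  using assms
proof (induction X arbitrary: p rule: finite_induct)
  case empty
  then obtain c where "p = mconst c"
    using poly_ring_empty by blast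
  with empty show ?case
    using mconst_unit[of c] by (auto simp: irreducible_def)
next
  case (insert v X)
  let ?Y = "insert v X"
  interpret Y: subring "poly_ring ?Y :: 'k mpoly set" by (rule subring_poly_ring)
  have X: "?Y - {v} = X" using insert by auto
  have pr: "prime_in (poly_ring ?Y) q" if "irreducible q" "q \<in> poly_ring (?Y - {v})" for q :: "'k mpoly"
    using insert that X by (auto intro!: prime_in_insert)
  show ?case
  proof (cases "mdeg v p = 0")
    case True
    then show ?thesis
      using pr[of p] insert.prems poly_ring_Diff by blast
  next
    case False
    note cancel = dvd_cancel_coefficient[OF pr insert.prems, of v, simplified X]
    have "p dvd a \<or> p dvd b"
      if ab: "a \<in> poly_ring ?Y" "b \<in> poly_ring ?Y" "p dvd a * b" for a b
    proof -
      have p0: "p \<noteq> 0"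
        using insert.prems by (auto simp: irreducible_def)
      have vY: "v \<in> ?Y" by simp
      obtain c u w h h' \<alpha> \<beta> where *: "{c, u, w, h, h'} \<subseteq> poly_ring ?Y" "{\<alpha>, \<beta>} \<subseteq> poly_ring X - {0}"
         "c \<noteq> 0" "c = u * p + w * a" "\<alpha> * p = c * h" "\<beta> * a = c * h'"
        by (rule mpoly_pseudo_gcd[OF vY insert.prems(2) p0 ab(1), unfolded X], rule that)
      have "\<exists>\<gamma> \<delta> c' h''. \<alpha> = \<gamma> * \<delta> \<and> c = \<gamma> * c' \<and> h = \<delta> * h'' \<and> p = c' * h''"
        by (rule split_product[OF pr]) (use * p0 X in auto)
      then obtain \<gamma> \<delta> c' h'' where s: "\<alpha> = \<gamma> * \<delta>" "c = \<gamma> * c'" "h = \<delta> * h''" "p = c' * h''"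
        by blast
      then have "c' dvd 1 \<or> h'' dvd 1"
        using insert.prems by (auto simp: irreducible_def)
      then show ?thesis
      proof
        \<comment> \<open>Here c' is associated to p, so p divides c and with it \<beta> *
          a.\<close>
        assume "h'' dvd 1"
        then obtain k where k: "1 = h'' * k" by blast
        have "\<beta> * a = \<gamma> * c' * (h'' * k) * h'"
          using *(6) s(2) by (simp flip: k)
        also have "\<dots> = p * (\<gamma> * k * h')"
          by (simp add: s(4) ac_simps)
        finally have "p dvd \<beta> * a"
          by simp
        then show ?thesis
          using cancel[of \<beta> a] False *(2) ab by auto
      next
        \<comment> \<open>Here c is free of x_v, and multiplying its Bezout identity by b shows that
          p divides c * b.\<close>
        assume c': "c' dvd 1"
        have "c \<in> poly_ring X"
        proof -
          have "\<gamma> \<in> poly_ring X"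
            using *(2) s(1) by (intro poly_ring_dvd_closed[of \<alpha> X \<gamma>]) auto
          then show ?thesis
            unfolding s(2) using unit_in_poly_ring[OF c'] by (intro subring.mult_closed[OF subring_poly_ring])
        qed
        moreover have "p dvd c * b"
        proof -
          have "c * b = p * (u * b) + w * (a * b)"
            by (simp add: *(4) algebra_simps)
          then show ?thesis
            using ab by auto
        qed
        ultimately show ?thesis
          using cancel[of c b] False *(3) ab by auto
      qed
    qed
    then show ?thesis
      by (auto simp: prime_in_def)
  qed
qed

theorem irreducible_dvd_mult_iff:
  fixes p :: "'k::field mpoly"
  assumes "irreducible p"
  shows "p dvd a * b \<longleftrightarrow> p dvd a \<or> p dvd b"
proof -
  obtain X where "finite X" "p \<in> poly_ring X" by (rule poly_ring_finite_vars)
  moreover obtain Y where "finite Y" "a \<in> poly_ring Y" by (rule poly_ring_finite_vars)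
  moreover obtain Z where "finite Z" "b \<in> poly_ring Z" by (rule poly_ring_finite_vars)
  ultimately have "finite (X \<union> Y \<union> Z)" "p \<in> poly_ring (X \<union> Y \<union> Z)"
    "a \<in> poly_ring (X \<union> Y \<union> Z)" "b \<in> poly_ring (X \<union> Y \<union> Z)"
    by (auto simp: in_poly_ring_iff)
  then have "p dvd a * b \<Longrightarrow> p dvd a \<or> p dvd b"
    using irreducible_prime_in[OF _ assms, of "X \<union> Y \<union> Z"] unfolding prime_in_def by blast
  then show ?thesis
    using dvd_mult dvd_mult2 by blast
qed

lemma irreducible_dvd_power:
  fixes p :: "'k::field mpoly"
  assumes "irreducible p" "p dvd a ^ n"
  shows "p dvd a"
  using assms(2)
proof (induction n)
  case 0
  then show ?case
    using assms(1) by (simp add: irreducible_def)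
next
  case (Suc n)
  then show ?case
    using irreducible_dvd_mult_iff[OF assms(1)] by auto
qed

lemma irreducible_not_dvd_low_degree:
  fixes p q :: "'k::field mpoly"
  assumes "mdeg v q < mdeg v p" "q \<noteq> 0"
  shows "\<not> p dvd q"
proof
  assume "p dvd q"
  then obtain r where "q = p * r" by blast
  with assms show False
    by (auto simp: mdeg_mult)
qed

text \<open>A substitute for the resultant. The pseudo-gcd c is not divisible by p, since otherwise
  p would divide \<beta> * q; so p divides h, and c divides \<alpha>, which is free of x_v.\<close>

lemma eliminate:
  fixes p q :: "'k::field mpoly"
  assumes p: "irreducible p" "p \<in> poly_ring X" "mdeg v p > 0"
    and q: "q \<in> poly_ring X" "\<not> p dvd q"
  shows "\<exists>u w. u * p + w * q \<noteq> 0 \<and> u * p + w * q \<in> poly_ring (X - {v})"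
proof -
  have p0: "p \<noteq> 0"
    using p by (auto simp: irreducible_def)
  have v: "v \<in> X"
    using p mdeg_eq_0 by fastforce
  obtain c u w h h' \<alpha> \<beta> where *: "{c, u, w, h, h'} \<subseteq> poly_ring X" "{\<alpha>, \<beta>} \<subseteq> poly_ring (X - {v}) - {0}"
     "c \<noteq> 0" "c = u * p + w * q" "\<alpha> * p = c * h" "\<beta> * q = c * h'"
    by (rule mpoly_pseudo_gcd[OF v p(2) p0 q(1)], rule that)
  have deg0: "mdeg v \<alpha> = 0" "mdeg v \<beta> = 0"
    using *(2) mdeg_eq_0[of _ "X - {v}" v] by auto
  have "p dvd c * h"
    by (simp flip: *(5))
  moreover have "\<not> p dvd c"
  proof
    assume "p dvd c"
    then have "p dvd \<beta> * q"
      by (simp add: *(6))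
    then show False
      using q(2) irreducible_dvd_mult_iff[OF p(1)] irreducible_not_dvd_low_degree[of v \<beta> p] deg0 p(3) *(2) by auto
  qed
  ultimately have "p dvd h"
    using irreducible_dvd_mult_iff[OF p(1)] by blast
  then obtain r where "h = p * r" by blast
  with *(5) p0 have "\<alpha> = c * r"
    by simp
  moreover have "\<alpha> \<noteq> 0"
    using *(2) by simp
  ultimately have "mdeg v c = 0"
    using deg0 by (auto simp: mdeg_mult)
  then have "c \<in> poly_ring (X - {v})"
    using *(1) poly_ring_Diff by auto
  then show ?thesis
    using * by auto
qed

section \<open>Zeros\<close>

text \<open>In a finite field, the product of all x - a, plus 1, would be nonconstant without a
  root.\<close>

lemma infinite_UNIV_alg_closed: "infinite (UNIV :: 'k::alg_closed_field set)"
proof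
  assume fin: "finite (UNIV :: 'k set)"
  define p where "p = (\<Prod>a\<in>UNIV. [:- a, 1 :: 'k:])"
  have "degree p = card (UNIV :: 'k set)"
    unfolding p_def by (subst degree_prod_eq_sum_degree) auto
  with fin have pos: "degree p > 0"
    by (simp add: finite_UNIV_card_ge_0)
  then have "degree (p + 1) > 0"
    by (subst degree_add_eq_left) auto
  then obtain x where "poly (p + 1) x = 0"
    using alg_closed_imp_poly_has_root by blast
  moreover have "poly p x = 0"
    unfolding p_def poly_prod using fin by (intro prod_zero) auto
  ultimately show False by simp
qed

lemma ex_poly_nonzero: "p \<noteq> 0 \<Longrightarrow> \<exists>x. poly p (x :: 'k::alg_closed_field) \<noteq> 0"
proof (rule ccontr)
  assume p: "p \<noteq> 0" "\<nexists>x. poly p x \<noteq> 0"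
  then have "{x. poly p x = 0} = UNIV"
    by auto
  with poly_roots_finite[OF p(1)] infinite_UNIV_alg_closed show False
    by metis
qed

text \<open>Induction on the variables: a point where the leading coefficient in x_v is nonzero
  leaves a nonzero univariate polynomial.\<close>

lemma ex_mpoly_eval_nonzero:
  fixes p :: "'k::alg_closed_field mpoly"
  assumes "p \<noteq> 0"
  shows "\<exists>a. mpoly_eval a p \<noteq> 0"
proof -
  obtain X where "finite X" "p \<in> poly_ring X"
    by (rule poly_ring_finite_vars)
  then show ?thesis
    using assms
  proof (induction X arbitrary: p rule: finite_induct)
    case empty
    then show ?case
      using poly_ring_empty[of p] by auto
  next
    case (insert v X)
    let ?c = "lead_coeff (to_poly v p)"
    have "?c \<in> poly_ring X"
      using to_poly_closed[OF insert.prems(1), of v] insert.hyps by (auto simp: polys_over_def)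
    moreover have "?c \<noteq> 0"
      using insert.prems by simp
    ultimately obtain a where "mpoly_eval a ?c \<noteq> 0"
      using insert.IH by blast
    then have "coeff (map_poly (mpoly_eval a) (to_poly v p)) (degree (to_poly v p)) \<noteq> 0"
      by (simp add: coeff_map_poly ring_hom.hom_zero[OF mpoly_eval_hom])
    then have "map_poly (mpoly_eval a) (to_poly v p) \<noteq> 0"
      by auto
    then obtain t where "poly (map_poly (mpoly_eval a) (to_poly v p)) t \<noteq> 0"
      using ex_poly_nonzero by blast
    then show ?case
      unfolding mpoly_eval_upd[symmetric] by blast
  qed
qed

lemma mpoly_eqI:
  fixes p q :: "'k::alg_closed_field mpoly"
  assumes "\<And>a. mpoly_eval a p = mpoly_eval a q"
  shows "p = q"
  using ex_mpoly_eval_nonzero[of "p - q"] assms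
  by (auto simp: ring_hom.hom_diff[OF mpoly_eval_hom])

lemma degree_eval_to_poly:
  assumes "mpoly_eval a (lead_coeff (to_poly v p)) \<noteq> 0"
  shows "degree (map_poly (mpoly_eval a) (to_poly v p)) = mdeg v p"
  unfolding mdeg_def using assms by (rule map_poly_degree_eq)

lemma irreducible_ex_var:
  fixes p :: "'k::field mpoly"
  assumes "irreducible p"
  obtains v where "mdeg v p > 0"
proof -
  have "p \<notin> poly_ring {}"
  proof
    assume "p \<in> poly_ring {}"
    then obtain c where "p = mconst c"
      using poly_ring_empty by blast
    then show False
      using assms mconst_unit[of c] by (auto simp: irreducible_def)
  qed
  then show ?thesis
    using that by (auto simp: in_poly_ring_iff)
qed

lemma lead_coeff_to_poly_in_poly_ring:
  "p \<in> poly_ring X \<Longrightarrow> lead_coeff (to_poly v p) \<in> poly_ring (X - {v})"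
  using to_poly_closed[of p X v] by (simp add: polys_over_def)

text \<open>If p does not divide q, the ideal of p and q contains some r \<noteq> 0 free of x_v.
  Over a point where r and the leading coefficient l of p are nonzero, p has a zero; there q and
  hence r would vanish.\<close>

theorem nullstellensatz_irreducible:
  fixes p q :: "'k::alg_closed_field mpoly"
  assumes p: "irreducible p" and zeros: "\<And>a. mpoly_eval a p = 0 \<Longrightarrow> mpoly_eval a q = 0"
  shows "p dvd q"
proof (rule ccontr)
  assume q: "\<not> p dvd q"
  obtain v where v: "mdeg v p > 0"
    using irreducible_ex_var[OF p] .
  have UNIV: "r \<in> poly_ring UNIV" for r :: "'k mpoly"
    by (simp add: poly_ring_def)
  obtain u w where r: "u * p + w * q \<noteq> 0" "u * p + w * q \<in> poly_ring (UNIV - {v})"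
    using eliminate[OF p UNIV v UNIV q] by blast
  define r where "r = u * p + w * q"
  define l where "l = lead_coeff (to_poly v p)"
  have "r * l \<noteq> 0"
    using r p by (auto simp: r_def l_def irreducible_def)
  then obtain a where "mpoly_eval a (r * l) \<noteq> 0"
    using ex_mpoly_eval_nonzero by blast
  then have a: "mpoly_eval a r \<noteq> 0" "mpoly_eval a l \<noteq> 0"
    by (auto simp: ring_hom.hom_mult[OF mpoly_eval_hom])
  have "degree (map_poly (mpoly_eval a) (to_poly v p)) > 0"
    using degree_eval_to_poly[of a v p] a v by (simp add: l_def)
  then obtain t where "poly (map_poly (mpoly_eval a) (to_poly v p)) t = 0"
    using alg_closed_imp_poly_has_root by blast
  then have "mpoly_eval (a(v := t)) p = 0"
    by (simp add: mpoly_eval_upd)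
  with zeros have "mpoly_eval (a(v := t)) r = 0"
    by (simp add: r_def ring_hom.hom_mult[OF mpoly_eval_hom] ring_hom.hom_add[OF mpoly_eval_hom])
  also have "mpoly_eval (a(v := t)) r = mpoly_eval a r"
    using r by (intro mpoly_eval_cong) (auto simp: r_def)
  finally show False
    using a by simp
qed

text \<open>Every irreducible factor of p divides q itself, so the exponent grows by one per
  factor.\<close>

theorem nullstellensatz_principal:
  fixes p q :: "'k::alg_closed_field mpoly"
  assumes "p \<noteq> 0" and "\<And>a. mpoly_eval a p = 0 \<Longrightarrow> mpoly_eval a q = 0"
  shows "\<exists>n. p dvd q ^ n"
  using assms
proof (induction p rule: mpoly_factor_induct)
  case (unit u)
  then show ?case by (intro exI[of _ 0]) simp
next
  case (mult p r)
  have "p dvd q"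
    using mult.prems by (intro nullstellensatz_irreducible mult.hyps(1))
      (simp add: ring_hom.hom_mult[OF mpoly_eval_hom])
  moreover obtain n where "r dvd q ^ n"
    using mult by (auto simp: ring_hom.hom_mult[OF mpoly_eval_hom])
  ultimately show ?case
    by (intro exI[of _ "Suc n"]) (simp add: mult_dvd_mono)
qed

section \<open>Constructible predicates and elimination of quantifiers\<close>

text \<open>Finite unions of locally closed sets. One inequation per piece suffices because
  inequations multiply. Predicates are on all assignments, of which only the coordinates in X are
  tested.\<close>

inductive constructible :: "nat set \<Rightarrow> ((nat \<Rightarrow> 'k::comm_ring_1) \<Rightarrow> bool) \<Rightarrow> bool" for X where
  basic: "finite P \<Longrightarrow> P \<subseteq> poly_ring X \<Longrightarrow> q \<in> poly_ring X \<Longrightarrow>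
    constructible X (\<lambda>a. (\<forall>p\<in>P. mpoly_eval a p = 0) \<and> mpoly_eval a q \<noteq> 0)"
| disj: "constructible X C \<Longrightarrow> constructible X D \<Longrightarrow> constructible X (\<lambda>a. C a \<or> D a)"

context
  fixes X :: "nat set"
begin

interpretation subring "poly_ring X :: 'k::idom mpoly set" by (rule subring_poly_ring)

lemma constructible_zero:
  "p \<in> poly_ring X \<Longrightarrow> constructible X (\<lambda>a. mpoly_eval a p = (0 :: 'k::idom))"
  using basic[of "{p}" X 1] by (simp add: ring_hom.hom_one[OF mpoly_eval_hom])

lemma constructible_nonzero:
  "p \<in> poly_ring X \<Longrightarrow> constructible X (\<lambda>a. mpoly_eval a p \<noteq> (0 :: 'k::idom))"
  using basic[of "{}" X p] by simp

lemma constructible_False: "constructible X (\<lambda>_ :: nat \<Rightarrow> 'k::idom. False)"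
  using constructible_zero[of "1 :: 'k mpoly"] by (simp add: ring_hom.hom_one[OF mpoly_eval_hom])

lemma constructible_True: "constructible X (\<lambda>_ :: nat \<Rightarrow> 'k::idom. True)"
  using constructible_zero[of "0 :: 'k mpoly"] by (simp add: ring_hom.hom_zero[OF mpoly_eval_hom])

lemma constructible_conj:
  fixes C D :: "(nat \<Rightarrow> 'k::idom) \<Rightarrow> bool"
  assumes "constructible X C" "constructible X D"
  shows "constructible X (\<lambda>a. C a \<and> D a)"
  using assms
proof (induction arbitrary: D)
  case (basic P q)
  note b = basic(1-3)
  from basic(4) show ?case
  proof induction
    case (basic P' q')
    have "constructible X (\<lambda>a. (\<forall>p\<in>P \<union> P'. mpoly_eval a p = 0) \<and> mpoly_eval a (q * q') \<noteq> 0)"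
      using b basic by (intro constructible.basic mult_closed) auto
    then show ?case
      by (simp add: ring_hom.hom_mult[OF mpoly_eval_hom] ball_Un conj_ac)
  next
    case (disj C D)
    from constructible.disj[OF disj(3,4)] show ?case
      by (simp add: conj_disj_distribL)
  qed
next
  case (disj C1 C2)
  from constructible.disj[OF disj(3,4)[OF disj(5)]] show ?case
    by (simp add: conj_disj_distribR)
qed

lemma constructible_Bex:
  fixes C :: "'i \<Rightarrow> (nat \<Rightarrow> 'k::idom) \<Rightarrow> bool"
  assumes "finite I" "\<And>i. i \<in> I \<Longrightarrow> constructible X (C i)"
  shows "constructible X (\<lambda>a. \<exists>i\<in>I. C i a)"
  using assms by (induction I rule: finite_induct) (auto intro: constructible_False constructible.disj)

lemma constructible_not:
  fixes C :: "(nat \<Rightarrow> 'k::idom) \<Rightarrow> bool"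
  assumes "constructible X C"
  shows "constructible X (\<lambda>a. \<not> C a)"
  using assms
proof induction
  case (basic P q)
  have "constructible X (\<lambda>a. (\<exists>p\<in>P. mpoly_eval a p \<noteq> 0) \<or> mpoly_eval a q = 0)"
    using basic by (intro constructible.disj constructible_Bex constructible_nonzero constructible_zero) auto
  then show ?case by simp
next
  case (disj C D)
  from constructible_conj[OF disj(3,4)] show ?case
    by simp
qed

lemma constructible_Ball:
  fixes C :: "'i \<Rightarrow> (nat \<Rightarrow> 'k::idom) \<Rightarrow> bool"
  assumes "finite I" "\<And>i. i \<in> I \<Longrightarrow> constructible X (C i)"
  shows "constructible X (\<lambda>a. \<forall>i\<in>I. C i a)"
  using assms by (induction I rule: finite_induct) (auto intro: constructible_True constructible_conj)

lemma constructible_if: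
  fixes C D E :: "(nat \<Rightarrow> 'k::idom) \<Rightarrow> bool"
  assumes "constructible X C" "constructible X D" "constructible X E"
  shows "constructible X (\<lambda>a. if C a then D a else E a)"
proof -
  have "constructible X (\<lambda>a. C a \<and> D a \<or> \<not> C a \<and> E a)"
    using assms by (intro constructible.disj constructible_conj constructible_not)
  then show ?thesis
    by (simp add: if_bool_eq_disj)
qed

end

section \<open>Elimination of one existential quantifier\<close>

lemma map_poly_eval_eq_0_iff:
  fixes p :: "'k::comm_ring_1 mpoly poly"
  shows "map_poly (mpoly_eval a) p = 0 \<longleftrightarrow> (\<forall>i\<in>{..degree p}. mpoly_eval a (coeff p i) = 0)"
proof
  assume *: "\<forall>i\<in>{..degree p}. mpoly_eval a (coeff p i) = 0"
  show "map_poly (mpoly_eval a) p = 0"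
  proof (rule poly_eqI)
    fix n show "coeff (map_poly (mpoly_eval a) p) n = coeff 0 n"
      using * by (cases "n \<le> degree p") (auto simp: coeff_map_poly coeff_eq_0 ring_hom.hom_zero[OF mpoly_eval_hom])
  qed
next
  assume "map_poly (mpoly_eval a) p = 0"
  then have "coeff (map_poly (mpoly_eval a) p) i = 0" for i
    by simp
  then show "\<forall>i\<in>{..degree p}. mpoly_eval a (coeff p i) = 0"
    by (simp add: coeff_map_poly ring_hom.hom_zero[OF mpoly_eval_hom])
qed

lemma constructible_map_poly_eq_0:
  fixes p :: "'k::idom mpoly poly"
  assumes "p \<in> polys_over (poly_ring X)"
  shows "constructible X (\<lambda>a. map_poly (mpoly_eval a) p = 0)"
  unfolding map_poly_eval_eq_0_iff
  by (intro constructible_Ball constructible_zero polys_overD[OF assms]) auto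

text \<open>Each linear factor of p uses up one factor q. The inclusion of root sets thus becomes a
  divisibility, which pseudo-division can test uniformly in parameters.\<close>

lemma roots_subset_iff_dvd_power:
  fixes p q :: "'k::alg_closed_field poly"
  assumes "p \<noteq> 0"
  shows "(\<forall>t. poly p t = 0 \<longrightarrow> poly q t = 0) \<longleftrightarrow> p dvd q ^ degree p"
proof
  assume dvd: "p dvd q ^ degree p"
  show "\<forall>t. poly p t = 0 \<longrightarrow> poly q t = 0"
  proof safe
    fix t assume "poly p t = 0"
    with dvd have "poly (q ^ degree p) t = 0"
      by (metis dvdE mult_zero_left poly_mult)
    then show "poly q t = 0"
      by simp
  qed
next
  assume "\<forall>t. poly p t = 0 \<longrightarrow> poly q t = 0"
  with assms show "p dvd q ^ degree p"
  proof (induction "degree p" arbitrary: p)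
    case 0
    then obtain c where "p = [:c:]"
      using degree_eq_zeroE by metis
    with 0 show ?case
      by (simp add: is_unit_const_poly_iff dvd_field_iff)
  next
    case (Suc n)
    then obtain t where t: "poly p t = 0"
      using alg_closed_imp_poly_has_root[of p] by auto
    then obtain p' where p': "p = [:- t, 1:] * p'"
      by (auto simp: poly_eq_0_iff_dvd)
    have "p' \<noteq> 0"
      using Suc.prems p' by auto
    then have deg: "degree p = Suc (degree p')"
      unfolding p' by (subst degree_mult_eq) auto
    have "p' dvd q ^ degree p'"
      using Suc \<open>p' \<noteq> 0\<close> deg p' by auto
    moreover have "[:- t, 1:] dvd q"
      using Suc.prems t by (simp add: poly_eq_0_iff_dvd)
    ultimately show ?case
      unfolding deg power_Suc by (subst p') (rule mult_dvd_mono)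
  qed
qed

text \<open>Zero ranks below the nonzero constants, so that replacing a constant by 0 also decreases
  the induction measure.\<close>

definition poly_size :: "'a::zero poly \<Rightarrow> nat" where
  "poly_size p = (if p = 0 then 0 else Suc (degree p))"

lemma sum_insert_remove_less:
  fixes m :: "'a \<Rightarrow> nat"
  assumes "finite P" "y \<in> P" "m x < m y"
  shows "sum m (insert x (P - {y})) < sum m P"
proof -
  have "sum m (insert x (P - {y})) \<le> m x + sum m (P - {y})"
    using assms by (simp add: sum.insert_if)
  also have "\<dots> < m y + sum m (P - {y})"
    using assms by simp
  also have "\<dots> = sum m P"
    using assms by (simp add: sum.remove)
  finally show ?thesis .
qed

text \<open>Induction on the total size of the equations. Let c be the leading coefficient of a
  nonzero p of least degree. Where c vanishes, p loses its top term; elsewhere another nonzero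
  equation is reduced modulo p. If there is none, the negation says that all roots of p are roots of
  q, which a pseudo-remainder decides.\<close>

lemma constructible_ex_poly:
  fixes q :: "'k::alg_closed_field mpoly poly"
  assumes "finite P" "P \<subseteq> polys_over (poly_ring X)" "q \<in> polys_over (poly_ring X)"
  shows "constructible X (\<lambda>a. \<exists>t. (\<forall>p\<in>P. poly (map_poly (mpoly_eval a) p) t = 0) \<and>
     poly (map_poly (mpoly_eval a) q) t \<noteq> 0)" (is "constructible X (?Q P)")
  using assms(1,2)
proof (induction "sum poly_size P" arbitrary: P rule: less_induct)
  case less
  interpret A: subring "poly_ring X :: 'k mpoly set" by (rule subring_poly_ring)
  interpret P: subring "polys_over (poly_ring X :: 'k mpoly set)" by (rule A.subring_polys_over)
  let ?E = "\<lambda>a. map_poly (mpoly_eval a) :: 'k mpoly poly \<Rightarrow> 'k poly"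
  have hom: "ring_hom (?E a)" for a
    by (rule ring_hom.map_poly_hom[OF mpoly_eval_hom])
  note E_simps = ring_hom.hom_add[OF hom] ring_hom.hom_diff[OF hom] ring_hom.hom_mult[OF hom]
    ring_hom.hom_power[OF hom]
  have E_monom: "?E a (monom c n) = monom (mpoly_eval a c) n" for a c n
    by (rule map_poly_monom) (rule ring_hom.hom_zero[OF mpoly_eval_hom])
  have E_smult: "?E a (smult c p) = smult (mpoly_eval a c) (?E a p)" for a c p
    by (rule map_poly_smult) (auto simp: ring_hom.hom_mult[OF mpoly_eval_hom] ring_hom.hom_zero[OF mpoly_eval_hom])
  show ?case
  proof (cases "\<forall>p\<in>P. p = 0")
    case True
    \<comment> \<open>Without equations, some t works iff the specialised q is nonzero, as the field
      is infinite.\<close>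
    have "?Q P = (\<lambda>a. \<not> ?E a q = 0)"
    proof
      fix a
      have "\<forall>p\<in>P. poly (?E a p) t = 0" for t
        using True by auto
      then show "?Q P a = (\<not> ?E a q = 0)"
        using ex_poly_nonzero[of "?E a q"] by auto
    qed
    then show ?thesis
      by (simp add: constructible_not constructible_map_poly_eq_0 assms(3))
  next
    case False
    then have "\<exists>p. p \<in> P \<and> p \<noteq> 0" by blast
    then obtain p where p: "p \<in> P" "p \<noteq> 0" and min: "\<And>p'. p' \<in> P \<Longrightarrow> p' \<noteq> 0 \<Longrightarrow> degree p \<le> degree p'"
      using ex_has_least_nat[of "\<lambda>p. p \<in> P \<and> p \<noteq> 0" _ degree] by blast
    have pA: "p \<in> polys_over (poly_ring X)"
      using p less.prems by blast
    define c where "c = lead_coeff p"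
    define p1 where "p1 = p - monom c (degree p)"
    have cA: "c \<in> poly_ring X"
      unfolding c_def using pA by (rule polys_overD)
    have "p1 = 0 \<or> degree p1 < degree p"
      unfolding p1_def c_def
      by (rule eq_zero_or_degree_less) (auto intro!: degree_diff_le degree_monom_le)
    then have size: "poly_size p1 < poly_size p"
      using p by (auto simp: poly_size_def)
    have p1A: "p1 \<in> polys_over (poly_ring X)"
      unfolding p1_def using pA cA by (intro P.diff_closed A.monom_in_polys_over)
    have C1: "constructible X (?Q (insert p1 (P - {p})))"
      using less.prems p1A
      by (intro less.hyps sum_insert_remove_less p size) auto
    have Q1: "?Q P a \<longleftrightarrow> ?Q (insert p1 (P - {p})) a" if "mpoly_eval a c = 0" for a
    proof -
      have "?E a p1 = ?E a p"
        unfolding p1_def by (simp add: E_simps E_monom that)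
      then have "(\<forall>p\<in>insert p1 (P - {p}). poly (?E a p) t = 0) \<longleftrightarrow> (\<forall>p\<in>P. poly (?E a p) t = 0)" for t
        using p(1) by (auto simp: ball_Un)
      then show ?thesis
        by simp
    qed
    have "\<exists>R. constructible X R \<and> (\<forall>a. mpoly_eval a c \<noteq> 0 \<longrightarrow> ?Q P a = R a)"
    proof (cases "\<exists>p2. p2 \<in> P \<and> p2 \<noteq> p \<and> p2 \<noteq> 0")
      case True
      then obtain p2 where p2: "p2 \<in> P" "p2 \<noteq> p" "p2 \<noteq> 0" by blast
      define m where "m = monom (lead_coeff p2) (degree p2 - degree p)"
      define r where "r = smult c p2 - m * p"
      have p2A: "p2 \<in> polys_over (poly_ring X)"
        using p2 less.prems by blast
      have rA: "r \<in> polys_over (poly_ring X)"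
        unfolding r_def m_def using pA p2A cA polys_overD[OF p2A]
        by (intro P.diff_closed P.mult_closed A.monom_in_polys_over A.smult_in_polys_over)
      have "r = 0 \<or> degree r < degree p2"
        unfolding r_def m_def c_def using p p2 min by (intro lead_reduction) auto
      then have "poly_size r < poly_size p2"
        using p2 by (auto simp: poly_size_def)
      then have "constructible X (?Q (insert r (P - {p2})))"
        using less.prems rA by (intro less.hyps sum_insert_remove_less p2(1)) auto
      \<comment> \<open>As c is nonzero at a, p and r have the same common zeros as p and
        p2.\<close>
      moreover have "?Q P a \<longleftrightarrow> ?Q (insert r (P - {p2})) a" if "mpoly_eval a c \<noteq> 0" for a
      proof -
        have "poly (?E a r) t = mpoly_eval a c * poly (?E a p2) t - poly (?E a m) t * poly (?E a p) t" for t
          unfolding r_def by (simp add: E_simps E_smult)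
        then have "(\<forall>p\<in>insert r (P - {p2}). poly (?E a p) t = 0) \<longleftrightarrow> (\<forall>p\<in>P. poly (?E a p) t = 0)" for t
          using p(1) p2 that by auto
        then show ?thesis
          by simp
      qed
      ultimately show ?thesis
        by blast
    next
      case False
      define N where "N = degree p"
      have "q ^ N \<in> polys_over (poly_ring X)"
        using assms(3) by (rule P.power_closed)
      from pseudo_division[OF subring_poly_ring this pA p(2)]
      obtain k h r where r: "smult (c ^ k) (q ^ N) = p * h + r" "r \<in> polys_over (poly_ring X)"
        "r = 0 \<or> degree r < degree p"
        unfolding c_def by blast
      \<comment> \<open>At a the degree of p stays N, so the exponent in
        \<open>roots_subset_iff_dvd_power\<close> does not depend on a, and the nonzero factor from
        \<open>c ^ k\<close> cancels.\<close>
      have "?Q P a \<longleftrightarrow> \<not> ?E a r = 0" if a: "mpoly_eval a c \<noteq> 0" for a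
      proof -
        have deg: "degree (?E a p) = N"
          unfolding N_def using a by (intro map_poly_degree_eq) (simp add: c_def)
        have "coeff (?E a p) N \<noteq> 0"
          using a by (simp add: coeff_map_poly c_def N_def ring_hom.hom_zero[OF mpoly_eval_hom])
        then have nz: "?E a p \<noteq> 0"
          by auto
        have eq: "smult (mpoly_eval a c ^ k) (?E a q ^ N) = ?E a p * ?E a h + ?E a r"
          using arg_cong[OF r(1), of "?E a"]
          by (simp add: E_simps E_smult ring_hom.hom_power[OF mpoly_eval_hom])
        have "?E a p dvd ?E a q ^ N \<longleftrightarrow> ?E a p dvd smult (mpoly_eval a c ^ k) (?E a q ^ N)"
          using a by (simp add: dvd_smult_iff)
        also have "\<dots> \<longleftrightarrow> ?E a p dvd ?E a r"
          unfolding eq by (simp add: dvd_add_right_iff)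
        also have "\<dots> \<longleftrightarrow> ?E a r = 0"
        proof
          assume dvd: "?E a p dvd ?E a r"
          show "?E a r = 0"
          proof (rule ccontr)
            assume nz': "?E a r \<noteq> 0"
            with dvd have "degree (?E a p) \<le> degree (?E a r)"
              by (rule dvd_imp_degree_le)
            also have "\<dots> \<le> degree r"
              by (rule map_poly_degree_leq)
            finally show False
              using r(3) nz' deg by (auto simp: N_def)
          qed
        qed simp
        finally have "?E a p dvd ?E a q ^ N \<longleftrightarrow> ?E a r = 0" .
        moreover have "(\<forall>p\<in>P. poly (?E a p) t = 0) \<longleftrightarrow> poly (?E a p) t = 0" for t
          using p(1) False by force
        ultimately show ?thesis
          using roots_subset_iff_dvd_power[OF nz, of "?E a q"] unfolding deg by simp blast
      qed
      then show ?thesis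
        using constructible_not[OF constructible_map_poly_eq_0[OF r(2)]] by blast
    qed
    then obtain R where R: "constructible X R" "\<And>a. mpoly_eval a c \<noteq> 0 \<Longrightarrow> ?Q P a = R a"
      by blast
    have "?Q P = (\<lambda>a. if mpoly_eval a c = 0 then ?Q (insert p1 (P - {p})) a else R a)"
      using Q1 R(2) by (intro ext) simp
    then show ?thesis
      using constructible_if[OF constructible_zero[OF cA] C1 R(1)] by simp
  qed
qed

theorem constructible_ex:
  fixes C :: "(nat \<Rightarrow> 'k::alg_closed_field) \<Rightarrow> bool"
  assumes "constructible X C"
  shows "constructible (X - {v}) (\<lambda>a. \<exists>t. C (a(v := t)))"
  using assms
proof induction
  case (basic P q)
  have "constructible (X - {v}) (\<lambda>a. \<exists>t. (\<forall>p\<in>to_poly v ` P. poly (map_poly (mpoly_eval a) p) t = 0) \<and>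
     poly (map_poly (mpoly_eval a) (to_poly v q)) t \<noteq> 0)"
    using basic by (intro constructible_ex_poly) (auto intro: to_poly_closed)
  then show ?case
    by (simp add: mpoly_eval_upd del: fun_upd_apply)
next
  case (disj C D)
  from constructible.disj[OF disj(3,4)] show ?case
    by (simp add: ex_disj_distrib del: fun_upd_apply)
qed

section \<open>Images of polynomial maps\<close>

lemma constructible_ex_vars:
  fixes C :: "(nat \<Rightarrow> 'k::alg_closed_field) \<Rightarrow> bool"
  assumes "finite V" "constructible (X \<union> V) C" "V \<inter> X = {}"
  shows "constructible X (\<lambda>a. \<exists>b. (\<forall>i. i \<notin> V \<longrightarrow> b i = a i) \<and> C b)"
  using assms
proof (induction V arbitrary: C rule: finite_induct)
  case empty
  have "(\<lambda>a. \<exists>b. (\<forall>i. i \<notin> {} \<longrightarrow> b i = a i) \<and> C b) = C"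
    by (auto simp flip: fun_eq_iff)
  with empty show ?case
    by simp
next
  case (insert v V)
  have "X \<union> insert v V - {v} = X \<union> V"
    using insert.hyps insert.prems(2) by auto
  with constructible_ex[OF insert.prems(1), of v] have "constructible (X \<union> V) (\<lambda>a. \<exists>t. C (a(v := t)))"
    by (simp only:)
  then have "constructible X (\<lambda>a. \<exists>b. (\<forall>i. i \<notin> V \<longrightarrow> b i = a i) \<and> (\<exists>t. C (b(v := t))))"
    using insert by auto
  moreover have "(\<exists>b. (\<forall>i. i \<notin> V \<longrightarrow> b i = a i) \<and> (\<exists>t. C (b(v := t)))) \<longleftrightarrow>
      (\<exists>b. (\<forall>i. i \<notin> insert v V \<longrightarrow> b i = a i) \<and> C b)" for a
  proof safe
    fix b t assume "\<forall>i. i \<notin> V \<longrightarrow> b i = a i" "C (b(v := t))"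
    then show "\<exists>b. (\<forall>i. i \<notin> insert v V \<longrightarrow> b i = a i) \<and> C b"
      by (intro exI[of _ "b(v := t)"]) auto
  next
    fix b assume "\<forall>i. i \<notin> insert v V \<longrightarrow> b i = a i" "C b"
    \<comment> \<open>The coordinate v is reset to that of a, as required outside V; its old value
      becomes the witness t.\<close>
    then show "\<exists>b. (\<forall>i. i \<notin> V \<longrightarrow> b i = a i) \<and> (\<exists>t. C (b(v := t)))"
      using insert.hyps by (intro exI[of _ "b(v := a v)"] conjI exI[of _ "b v"]) auto
  qed
  ultimately show ?case
    by simp
qed

text \<open>Chevalley's theorem for a polynomial map. Shifting the source variables by M makes room
  for the target, so that the graph is given by equations; the source variables are then
  eliminated.\<close>

theorem constructible_range:
  fixes F :: "nat \<Rightarrow> 'k::alg_closed_field mpoly"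
  assumes "\<And>i. i < M \<Longrightarrow> F i \<in> poly_ring {..<n}"
  shows "constructible {..<M} (\<lambda>x. \<exists>a. \<forall>i<M. mpoly_eval a (F i) = x i)"
proof -
  define G where "G i = mpoly_subst (\<lambda>j. mvar (j + M)) (F i)" for i
  have G: "G i \<in> poly_ring ({..<M} \<union> {M..<M+n})" if "i < M" for i
    unfolding G_def by (rule mpoly_subst_closed[OF _ assms[OF that]]) auto
  have ev_G: "mpoly_eval b (G i) = mpoly_eval (\<lambda>j. b (j + M)) (F i)" for b i
    unfolding G_def by (simp add: mpoly_eval_subst)
  let ?C = "\<lambda>b. \<forall>i\<in>{..<M}. mpoly_eval b (mvar i - G i) = 0"
  have "constructible ({..<M} \<union> {M..<M+n}) ?C"
    using G by (intro constructible_Ball constructible_zero subring.diff_closed[OF subring_poly_ring]) auto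
  then have "constructible {..<M} (\<lambda>x. \<exists>b. (\<forall>i. i \<notin> {M..<M+n} \<longrightarrow> b i = x i) \<and> ?C b)"
    by (intro constructible_ex_vars) auto
  moreover have "(\<exists>b. (\<forall>i. i \<notin> {M..<M+n} \<longrightarrow> b i = x i) \<and> ?C b) \<longleftrightarrow>
     (\<exists>a. \<forall>i<M. mpoly_eval a (F i) = x i)" for x
  proof
    assume "\<exists>b. (\<forall>i. i \<notin> {M..<M+n} \<longrightarrow> b i = x i) \<and> ?C b"
    then obtain b where "\<forall>i. i \<notin> {M..<M+n} \<longrightarrow> b i = x i" "?C b" by blast
    then show "\<exists>a. \<forall>i<M. mpoly_eval a (F i) = x i"
      by (intro exI[of _ "\<lambda>j. b (j + M)"])
        (auto simp: ring_hom.hom_diff[OF mpoly_eval_hom] ev_G)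
  next
    assume "\<exists>a. \<forall>i<M. mpoly_eval a (F i) = x i"
    then obtain a where a: "\<forall>i<M. mpoly_eval a (F i) = x i" by blast
    define b where "b i = (if i \<in> {M..<M+n} then a (i - M) else x i)" for i
    have "mpoly_eval (\<lambda>j. b (j + M)) (F i) = mpoly_eval a (F i)" if "i < M" for i
      by (rule mpoly_eval_cong[OF assms[OF that]]) (auto simp: b_def)
    then have "?C b"
      using a by (auto simp: ring_hom.hom_diff[OF mpoly_eval_hom] ev_G b_def)
    then show "\<exists>b. (\<forall>i. i \<notin> {M..<M+n} \<longrightarrow> b i = x i) \<and> ?C b"
      by (intro exI[of _ b]) (auto simp: b_def)
  qed
  ultimately show ?thesis
    by simp
qed

text \<open>With \<open>p = 0\<close> this concerns the whole space, with \<open>p\<close> irreducible a hypersurface.\<close>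

theorem constructible_generic [consumes 2, case_names generic negligible]:
  fixes p :: "'k::field mpoly" and C :: "(nat \<Rightarrow> 'k) \<Rightarrow> bool"
  assumes C: "constructible X C" and p: "p = 0 \<or> irreducible p"
  obtains (generic) q where "q \<in> poly_ring X" "\<not> p dvd q"
      "\<And>a. mpoly_eval a p = 0 \<Longrightarrow> mpoly_eval a q \<noteq> 0 \<Longrightarrow> C a"
    | (negligible) q where "q \<in> poly_ring X" "\<not> p dvd q"
      "\<And>a. mpoly_eval a p = 0 \<Longrightarrow> C a \<Longrightarrow> mpoly_eval a q = 0"
proof -
  have "(\<exists>q\<in>poly_ring X. \<not> p dvd q \<and> (\<forall>a. mpoly_eval a p = 0 \<longrightarrow> mpoly_eval a q \<noteq> 0 \<longrightarrow> C a)) \<or>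
     (\<exists>q\<in>poly_ring X. \<not> p dvd q \<and> (\<forall>a. mpoly_eval a p = 0 \<longrightarrow> C a \<longrightarrow> mpoly_eval a q = 0))"
    using C
  proof induction
    case (basic P q)
    have ev_0: "mpoly_eval a r = 0" if "p dvd r" "mpoly_eval a p = 0" for a r
      using that by (auto elim!: dvdE simp: ring_hom.hom_mult[OF mpoly_eval_hom])
    \<comment> \<open>An equation r not divisible by p confines the predicate to zeros of r; if p
      divides q, it is false on p = 0; otherwise it holds there wherever q is nonzero.\<close>
    consider r where "r \<in> P" "\<not> p dvd r" | "p dvd q" | "\<forall>r\<in>P. p dvd r" "\<not> p dvd q"
      by blast
    then show ?case
    proof cases
      case 1
      then show ?thesis using basic by blast
    next
      case 2
      have "\<not> p dvd 1"
        using p by (auto simp: irreducible_def)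
      moreover have "(1 :: 'k mpoly) \<in> poly_ring X"
        by (rule subring.one_closed[OF subring_poly_ring])
      ultimately show ?thesis
        using ev_0[OF 2] by blast
    next
      case 3
      then show ?thesis using basic ev_0 by blast
    qed
  next
    case (disj C D)
    \<comment> \<open>Primality of p is what lets two negligible pieces have a negligible
      union.\<close>
    have mult: "\<not> p dvd q * q'" if "\<not> p dvd q" "\<not> p dvd q'" for q q'
      using p that irreducible_dvd_mult_iff by auto
    from disj.IH show ?case
    proof (elim disjE bexE conjE)
      fix q q'
      assume *: "q \<in> poly_ring X" "q' \<in> poly_ring X" "\<not> p dvd q" "\<not> p dvd q'"
        "\<forall>a. mpoly_eval a p = 0 \<longrightarrow> C a \<longrightarrow> mpoly_eval a q = 0"
        "\<forall>a. mpoly_eval a p = 0 \<longrightarrow> D a \<longrightarrow> mpoly_eval a q' = 0"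
      have "q * q' \<in> poly_ring X"
        using * by (intro subring.mult_closed[OF subring_poly_ring])
      moreover have "\<forall>a. mpoly_eval a p = 0 \<longrightarrow> C a \<or> D a \<longrightarrow> mpoly_eval a (q * q') = 0"
        using * by (auto simp: ring_hom.hom_mult[OF mpoly_eval_hom])
      ultimately show ?thesis
        using mult[OF *(3,4)] by blast
    qed blast+
  qed
  then show ?thesis
    using generic negligible by blast
qed

section \<open>Univariate polynomials with a single root\<close>

text \<open>Only the binomial term with \<open>k = e - 1\<close> reaches this degree.\<close>

lemma coeff_binomial_power:
  fixes b :: "'a::comm_semiring_1"
  assumes "q > 0" "e > 0"
  shows "coeff ((monom 1 q + [:b:]) ^ e) (q * (e - 1)) = of_nat e * b"
proof -
  have "coeff ((monom 1 q + [:b:]) ^ e) (q * (e - 1)) =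
      (\<Sum>k\<le>e. b ^ (e - k) * of_nat (e choose k) * (if k = e - 1 then 1 else 0))"
    using assms(1)
    by (subst binomial_ring) (simp add: coeff_sum of_nat_poly monom_power poly_const_pow mult_ac)
  also have "\<dots> = (\<Sum>k\<in>{e - 1}. b ^ (e - k) * of_nat (e choose k))"
    using assms by (intro sum.mono_neutral_cong_right) auto
  also have "\<dots> = of_nat e * b"
    using assms by (cases e) (auto simp: mult.commute)
  finally show ?thesis .
qed

text \<open>p divides a power of the linear factor that has the same degree, so the cofactor is
  constant.\<close>

lemma single_root_power:
  fixes p :: "'k::alg_closed_field poly"
  assumes "p \<noteq> 0" "\<And>t. poly p t = 0 \<Longrightarrow> t = t0"
  shows "p = smult (lead_coeff p) ([:- t0, 1:] ^ degree p)"
proof -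
  have "p dvd [:- t0, 1:] ^ degree p"
    using roots_subset_iff_dvd_power[OF assms(1), of "[:- t0, 1:]"] assms(2) by simp
  then obtain k where k: "[:- t0, 1:] ^ degree p = p * k" by blast
  have "p * k \<noteq> 0"
    by (simp flip: k)
  then have "k \<noteq> 0" by auto
  have "degree (p * k) = degree p"
    by (simp flip: k add: degree_linear_power)
  with assms(1) \<open>k \<noteq> 0\<close> have "degree k = 0"
    by (simp add: degree_mult_eq)
  then obtain c where c: "k = [:c:]"
    by (rule degree_eq_zeroE)
  have "lead_coeff ([:- t0, 1:] ^ degree p) = 1"
    by (simp add: lead_coeff_power)
  then have "lead_coeff p * c = 1"
    unfolding k lead_coeff_mult by (simp add: c)
  then show ?thesis
    by (simp add: k c)
qed

text \<open>By Frobenius, p is its leading coefficient times (y^q - t0^q)^e; the coefficients of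
  degree \<open>q * (e - 1)\<close> are compared.\<close>

lemma single_root_char:
  fixes p :: "'k::alg_closed_field poly"
  assumes "prime CHAR('k)" "p \<noteq> 0" and root: "\<And>t. poly p t = 0 \<longleftrightarrow> t = t0"
    and "degree p = q * e" "q = CHAR('k) ^ \<nu>" "e > 0"
  shows "of_nat e * lead_coeff p * t0 ^ q + coeff p (q * (e - 1)) = 0"
proof -
  have q: "q > 0"
    using assms by (simp add: prime_gt_0_nat)
  have "[:- t0, 1:] ^ q = (monom 1 1 + [:- t0:]) ^ q"
    by (simp add: monom_altdef)
  also have "\<dots> = monom 1 q + [:(- t0) ^ q:]"
    using assms(1,5) by (subst freshmans_dream'[of q \<nu>]) (simp_all add: monom_power poly_const_pow)
  finally have pow: "[:- t0, 1:] ^ q = monom 1 q + [:(- t0) ^ q:]" .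
  have "coeff p (q * (e - 1)) = coeff (smult (lead_coeff p) (([:- t0, 1:] ^ q) ^ e)) (q * (e - 1))"
    using single_root_power[OF assms(2), of t0] root assms(4) by (simp flip: power_mult)
  also have "\<dots> = lead_coeff p * (of_nat e * (- t0) ^ q)"
    by (simp only: pow coeff_smult coeff_binomial_power[OF q \<open>e > 0\<close>])
  finally have "of_nat e * lead_coeff p * t0 ^ q + coeff p (q * (e - 1)) =
      of_nat e * lead_coeff p * (t0 ^ q + (- t0) ^ q)"
    by (simp add: algebra_simps)
  \<comment> \<open>Frobenius once more, in place of a case distinction on the parity of q.\<close>
  also have "t0 ^ q + (- t0) ^ q = (t0 + - t0) ^ q"
    using assms by (intro freshmans_dream'[symmetric]) auto
  finally show ?thesis
    using q by (simp add: zero_power)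
qed

section \<open>Determined polynomials\<close>

lemma mpoly_eval_restrict:
  "p \<in> poly_ring X \<Longrightarrow> mpoly_eval (restrict a X) p = mpoly_eval a p"
  by (rule mpoly_eval_cong) auto

text \<open>Coordinates from n on do not affect the values, so arbitrary assignments may replace the
  points of \<open>affine_space n\<close>.\<close>

lemma determined_polys_iff:
  assumes "\<And>i. i < m \<Longrightarrow> f i \<in> poly_ring {..<n}"
  shows "g \<in> determined_polys n m f \<longleftrightarrow> g \<in> poly_ring {..<n} \<and>
    (\<forall>a b. (\<forall>i<m. mpoly_eval a (f i) = mpoly_eval b (f i)) \<longrightarrow> mpoly_eval a g = mpoly_eval b g)"
proof (intro iffI conjI allI impI)
  fix a b
  assume g: "g \<in> determined_polys n m f" and eq: "\<forall>i<m. mpoly_eval a (f i) = mpoly_eval b (f i)"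
  then have gn: "g \<in> poly_ring {..<n}"
    by (simp add: determined_polys_def)
  have "\<forall>i<m. mpoly_eval (restrict a {..<n}) (f i) = mpoly_eval (restrict b {..<n}) (f i)"
    using eq assms by (simp add: mpoly_eval_restrict)
  moreover have "restrict x {..<n} \<in> affine_space n" for x :: "nat \<Rightarrow> 'a"
    by (simp add: affine_space_def)
  ultimately have "mpoly_eval (restrict a {..<n}) g = mpoly_eval (restrict b {..<n}) g"
    using g unfolding determined_polys_def by blast
  then show "mpoly_eval a g = mpoly_eval b g"
    using gn by (simp add: mpoly_eval_restrict)
qed (auto simp: determined_polys_def)

section \<open>Algebraic relations and the image of a polynomial map\<close>

lemma mpoly_subst_cong:
  assumes "p \<in> poly_ring X" "\<And>i. i \<in> X \<Longrightarrow> f i = g i"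
  shows "mpoly_subst f p = mpoly_subst g p"
  unfolding mpoly_subst_def using assms by (rule insertion_cong)

lemma mpoly_subst_eq_0_iff:
  fixes F :: "nat \<Rightarrow> 'k::alg_closed_field mpoly"
  assumes "q \<in> poly_ring {..<M}"
  shows "mpoly_subst F q = 0 \<longleftrightarrow>
    (\<forall>x. (\<exists>a. \<forall>i<M. mpoly_eval a (F i) = x i) \<longrightarrow> mpoly_eval x q = 0)"
proof safe
  fix x a assume *: "mpoly_subst F q = 0" "\<forall>i<M. mpoly_eval a (F i) = x i"
  have "mpoly_eval x q = mpoly_eval (\<lambda>i. mpoly_eval a (F i)) q"
    using assms * by (intro mpoly_eval_cong) auto
  also have "\<dots> = mpoly_eval a (mpoly_subst F q)"
    by (simp add: mpoly_eval_subst)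
  finally show "mpoly_eval x q = 0"
    by (simp add: * ring_hom.hom_zero[OF mpoly_eval_hom])
next
  assume *: "\<forall>x. (\<exists>a. \<forall>i<M. mpoly_eval a (F i) = x i) \<longrightarrow> mpoly_eval x q = 0"
  have "mpoly_eval (\<lambda>i. mpoly_eval a (F i)) q = 0" for a
    using *[rule_format, of "\<lambda>i. mpoly_eval a (F i)"] by blast
  then show "mpoly_subst F q = 0"
    by (intro mpoly_eqI) (simp add: mpoly_eval_subst ring_hom.hom_zero[OF mpoly_eval_hom])
qed

text \<open>Substitution is a homomorphism into a domain: it kills no unit, hence it kills one of
  the irreducible factors of h.\<close>

lemma mpoly_subst_ex_irreducible:
  fixes h :: "'k::field mpoly"
  assumes "h \<noteq> 0" "mpoly_subst F h = 0"
  shows "\<exists>p. irreducible p \<and> p dvd h \<and> mpoly_subst F p = 0"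
  using assms
proof (induction h rule: mpoly_factor_induct)
  case (unit u)
  then obtain k where k: "1 = u * k" by blast
  have "mpoly_subst F (u * k) = 0"
    using unit by (simp add: ring_hom.hom_mult[OF mpoly_subst_hom])
  then show ?case
    by (simp add: ring_hom.hom_one[OF mpoly_subst_hom] flip: k)
next
  case (mult p r)
  then have "mpoly_subst F p = 0 \<or> mpoly_subst F r = 0"
    by (simp add: ring_hom.hom_mult[OF mpoly_subst_hom])
  then show ?case
    using mult.hyps(1) mult.IH by (meson dvd_mult dvd_triv_left)
qed

text \<open>The irreducible relation P between f and g has a single root over generic values of f.
  This forces \<open>P = l * mvar m ^ q + c\<close>, and then s = l and r = -c.\<close>

lemma determined_imp_purely_inseparable:
  fixes f :: "nat \<Rightarrow> 'k::alg_closed_field mpoly"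
  assumes char: "CHAR('k) > 0"
    and f: "\<And>i. i < m \<Longrightarrow> f i \<in> poly_ring {..<n}"
    and indep: "algebraically_independent m f"
    and g: "g \<in> determined_polys n m f"
  obtains s r \<nu> where "s \<in> poly_ring {..<m}" "r \<in> poly_ring {..<m}" "s \<noteq> 0"
    "\<And>p. irreducible p \<Longrightarrow> p dvd s \<Longrightarrow> \<not> p dvd r"
    "mpoly_subst f s * g ^ (CHAR('k) ^ \<nu>) = mpoly_subst f r"
proof -
  define F where "F = f(m := g)"
  have F: "F i \<in> poly_ring {..<n}" if "i < Suc m" for i
    using that f g by (auto simp: F_def determined_polys_def less_Suc_eq)
  have subst_F: "mpoly_subst F q = mpoly_subst f q" if "q \<in> poly_ring {..<m}" for q
    by (rule mpoly_subst_cong[OF that]) (auto simp: F_def)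
  have indep': "q = 0" if "q \<in> poly_ring {..<m}" "mpoly_subst F q = 0" for q
    using indep that subst_F by (auto simp: algebraically_independent_def)
  \<comment> \<open>The image of (f, g). Since g is determined by f, it is a graph over the first m
    coordinates, which \<open>fibre\<close> records.\<close>
  define R where "R x \<longleftrightarrow> (\<exists>a. \<forall>i<Suc m. mpoly_eval a (F i) = x i)" for x
  have constr: "constructible {..<Suc m} R"
    unfolding R_def[abs_def] by (rule constructible_range[OF F])
  have subst_0: "mpoly_subst F q = 0 \<longleftrightarrow> (\<forall>x. R x \<longrightarrow> mpoly_eval x q = 0)" if "q \<in> poly_ring {..<Suc m}" for q
    unfolding R_def by (rule mpoly_subst_eq_0_iff[OF that])
  have determined: "mpoly_eval a g = mpoly_eval b g"
    if "\<forall>i<m. mpoly_eval a (f i) = mpoly_eval b (f i)" for a b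
    using iffD1[OF determined_polys_iff[OF f] g] that by blast
  have fibre: "t = t'" if R: "R (x(m := t))" "R (x(m := t'))" for x t t'
  proof -
    obtain a where a: "\<And>i. i < Suc m \<Longrightarrow> mpoly_eval a (F i) = (x(m := t)) i"
      using R(1) unfolding R_def by blast
    obtain a' where a': "\<And>i. i < Suc m \<Longrightarrow> mpoly_eval a' (F i) = (x(m := t')) i"
      using R(2) unfolding R_def by blast
    have "mpoly_eval a (f i) = mpoly_eval a' (f i)" if "i < m" for i
      using a[of i] a'[of i] that by (simp add: F_def)
    then have "mpoly_eval a g = mpoly_eval a' g"
      using determined by blast
    then show "t = t'"
      using a[of m] a'[of m] by (simp add: F_def)
  qed
  \<comment> \<open>If the image contained a nonempty open set, a line parallel to the last axis
    would meet it twice.\<close>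
  have "\<exists>h\<in>poly_ring {..<Suc m}. h \<noteq> 0 \<and> mpoly_subst F h = 0"
    using constr disjI1[OF refl]
  proof (cases rule: constructible_generic)
    case (generic q)
    then obtain a where a: "mpoly_eval a q \<noteq> 0"
      using ex_mpoly_eval_nonzero[of q] by auto
    define u where "u = map_poly (mpoly_eval a) (to_poly m q)"
    have u: "poly u t = mpoly_eval (a(m := t)) q" for t
      by (simp add: u_def mpoly_eval_upd)
    have "poly u (a m) \<noteq> 0"
      using a by (simp add: u)
    then have "u \<noteq> 0"
      by auto
    \<comment> \<open>The second factor keeps t different from \<open>a m\<close>.\<close>
    then have "u * [:- a m, 1:] \<noteq> 0"
      by (subst mult_eq_0_iff) simp
    then obtain t where t: "poly (u * [:- a m, 1:]) t \<noteq> 0"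
      using ex_poly_nonzero by blast
    then have "R (a(m := t))" "R (a(m := a m))"
      using a generic(3) by (auto simp: u ring_hom.hom_zero[OF mpoly_eval_hom])
    from fibre[OF this] t show ?thesis
      by simp
  next
    case (negligible q)
    then show ?thesis
      using subst_0[of q] by (auto simp: ring_hom.hom_zero[OF mpoly_eval_hom])
  qed
  then obtain h where h: "h \<in> poly_ring {..<Suc m}" "h \<noteq> 0" "mpoly_subst F h = 0" by blast
  obtain P where P: "irreducible P" "P dvd h" and PF: "mpoly_subst F P = 0"
    using mpoly_subst_ex_irreducible[OF h(2,3)] by blast
  have PX: "P \<in> poly_ring {..<Suc m}"
    using h(1) P(2) h(2) by (rule poly_ring_dvd_closed)
  have P0: "P \<noteq> 0"
    using P by (auto simp: irreducible_def)
  have X: "{..<Suc m} - {m} = {..<m}"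
    by auto
  have degP: "mdeg m P > 0"
    using poly_ring_Diff[OF PX, of m] indep'[of P] P0 PF unfolding X by auto
  have elim: "\<exists>u w. u * P + w * q \<noteq> 0 \<and> u * P + w * q \<in> poly_ring {..<m}"
    if "q \<in> poly_ring {..<Suc m}" "\<not> P dvd q" for q
    using eliminate[OF P(1) PX degP that] unfolding X .
  \<comment> \<open>A relation not divisible by P could be combined with P into a nonzero relation
    without x_m, that is, among f alone.\<close>
  have minimal: "P dvd q" if "q \<in> poly_ring {..<Suc m}" "mpoly_subst F q = 0" for q
  proof (rule ccontr)
    assume "\<not> P dvd q"
    from elim[OF that(1) this] obtain u w where
      "u * P + w * q \<noteq> 0" "u * P + w * q \<in> poly_ring {..<m}" by blast
    moreover have "mpoly_subst F (u * P + w * q) = 0"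
      by (simp add: ring_hom.hom_mult[OF mpoly_subst_hom] ring_hom.hom_add[OF mpoly_subst_hom] PF that)
    ultimately show False
      using indep' by blast
  qed
  \<comment> \<open>The negligible case cannot occur: a polynomial vanishing on the image is a
    relation, hence a multiple of P.\<close>
  obtain Q where Q: "Q \<in> poly_ring {..<Suc m}" "\<not> P dvd Q"
    "\<And>x. mpoly_eval x P = 0 \<Longrightarrow> mpoly_eval x Q \<noteq> 0 \<Longrightarrow> R x"
    using constr disjI2[OF P(1)]
  proof (cases rule: constructible_generic)
    case (negligible q)
    then have "mpoly_subst F q = 0"
      using subst_0[OF PX] PF by (subst subst_0) auto
    with negligible minimal show ?thesis by blast
  qed (rule that)
  from elim[OF Q(1,2)] obtain u w where
    D0: "u * P + w * Q \<noteq> 0" and DX: "u * P + w * Q \<in> poly_ring {..<m}" by blast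
  \<comment> \<open>D is free of x_m and equals w * Q on the zeros of P, so if D is nonzero at x,
    then Q is nonzero at every zero of P that differs from x only in coordinate m.\<close>
  define D where "D = u * P + w * Q"
  define l where "l = lead_coeff (to_poly m P)"
  have lX: "l \<in> poly_ring {..<m}"
    unfolding l_def using lead_coeff_to_poly_in_poly_ring[OF PX, of m] unfolding X .
  have l0: "l \<noteq> 0"
    unfolding l_def using P0 by simp
  have prime: "prime CHAR('k)"
    using char by (rule prime_CHAR_semidom)
  have "CHAR('k) \<noteq> 1"
    using prime by auto
  \<comment> \<open>The degree of P in x_m is split into a power q of the characteristic and a
    factor e that is nonzero in k.\<close>
  then obtain e where e: "mdeg m P = CHAR('k) ^ multiplicity CHAR('k) (mdeg m P) * e" "\<not> CHAR('k) dvd e"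
    using multiplicity_decompose'[of "mdeg m P" "CHAR('k)"] degP by auto
  define \<nu> where "\<nu> = multiplicity CHAR('k) (mdeg m P)"
  define q where "q = CHAR('k) ^ \<nu>"
  have q: "q > 0"
    using prime by (simp add: q_def prime_gt_0_nat)
  have eq: "mdeg m P = q * e"
    using e(1) by (simp only: q_def \<nu>_def)
  have e0: "e > 0"
    using e(2) by (cases "e = 0") auto
  have e_nz: "of_nat e \<noteq> (0 :: 'k)"
    using e(2) by (simp add: of_nat_eq_0_iff_char_dvd)
  define c where "c = coeff (to_poly m P) (q * (e - 1))"
  have cX: "c \<in> poly_ring {..<m}"
    unfolding c_def using polys_overD[OF to_poly_closed[OF PX, of m]] unfolding X .
  \<comment> \<open>The left side of \<open>single_root_char\<close>, with x_m as the root and the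
    coefficients of P in place of their values.\<close>
  define T where "T = mconst (of_nat e) * l * mvar m ^ q + c"
  \<comment> \<open>Where D and l are nonzero, every root of the specialised P gives a point of the
    image, so \<open>x m\<close> is the only root.\<close>
  have vanish: "mpoly_eval x (D * l * T) = 0" if x: "mpoly_eval x P = 0" for x
  proof (cases "mpoly_eval x D = 0 \<or> mpoly_eval x l = 0")
    case False
    define p where "p = map_poly (mpoly_eval x) (to_poly m P)"
    have lead: "coeff p (mdeg m P) = mpoly_eval x l"
      by (simp add: p_def mdeg_def l_def coeff_map_poly ring_hom.hom_zero[OF mpoly_eval_hom])
    have deg: "degree p = mdeg m P"
      unfolding p_def using False by (intro degree_eval_to_poly) (auto simp: l_def)
    have R: "R (x(m := t))" if "poly p t = 0" for t
    proof (rule Q(3))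
      show P_t: "mpoly_eval (x(m := t)) P = 0"
        using that by (simp add: mpoly_eval_upd p_def)
      have "mpoly_eval (x(m := t)) D = mpoly_eval x D"
        using DX unfolding D_def by (rule mpoly_eval_cong) auto
      then show "mpoly_eval (x(m := t)) Q \<noteq> 0"
        using False P_t
        by (auto simp: D_def ring_hom.hom_mult[OF mpoly_eval_hom] ring_hom.hom_add[OF mpoly_eval_hom])
    qed
    have root: "poly p (x m) = 0"
      using x by (simp add: p_def flip: mpoly_eval_upd)
    have "of_nat e * lead_coeff p * x m ^ q + coeff p (q * (e - 1)) = 0"
    proof (rule single_root_char[OF prime])
      show "p \<noteq> 0"
        using False lead by auto
      show "poly p t = 0 \<longleftrightarrow> t = x m" for t
        using root fibre[OF R R] by blast
    qed (use deg eq q_def e0 in auto)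
    moreover have "lead_coeff p = mpoly_eval x l" "coeff p (q * (e - 1)) = mpoly_eval x c"
      using lead deg by (simp_all add: c_def p_def coeff_map_poly ring_hom.hom_zero[OF mpoly_eval_hom])
    ultimately have "mpoly_eval x T = 0"
      by (simp add: T_def ring_hom.hom_mult[OF mpoly_eval_hom] ring_hom.hom_add[OF mpoly_eval_hom]
        ring_hom.hom_power[OF mpoly_eval_hom])
    then show ?thesis
      by (simp add: ring_hom.hom_mult[OF mpoly_eval_hom])
  qed (auto simp: ring_hom.hom_mult[OF mpoly_eval_hom])
  have low: "\<not> P dvd d" if "d \<in> poly_ring {..<m}" "d \<noteq> 0" for d
    using that degP mdeg_eq_0[of d "{..<m}" m] by (intro irreducible_not_dvd_low_degree[of m]) auto
  have "P dvd D * l * T"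
    by (rule nullstellensatz_irreducible[OF P(1) vanish])
  then have "P dvd T"
    using low[of D] low[of l] D0 DX lX l0 by (auto simp: D_def irreducible_dvd_mult_iff[OF P(1)])
  have elX: "mconst (of_nat e) * l \<in> poly_ring {..<m}"
    using lX by (intro subring.mult_closed[OF subring_poly_ring]) auto
  have to_T: "to_poly m T = monom (mconst (of_nat e) * l) q + [:c:]"
  proof -
    have T: "T = poly (monom (mconst (of_nat e) * l) q + [:c:]) (mvar m)"
      by (simp add: T_def poly_monom)
    have "monom (mconst (of_nat e) * l) q + [:c:] \<in> polys_over (poly_ring {..<m})"
      using elX cX
      by (intro subring.add_closed[OF subring.subring_polys_over] subring.monom_in_polys_over
          subring.const_in_polys_over subring_poly_ring)
    then show ?thesis
      unfolding T by (rule to_poly_poly) simp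
  qed
  have "degree (monom (mconst (of_nat e) * l) q + [:c:]) = q"
    using e_nz l0 q by (subst degree_add_eq_left) (auto simp: degree_monom_eq)
  then have degT: "mdeg m T = q"
    by (simp add: mdeg_def to_T)
  with q have "T \<noteq> 0"
    by (auto simp: mdeg_def ring_hom.hom_zero[OF to_poly_hom])
  \<comment> \<open>T is a nonzero multiple of P, but its degree in x_m is only q.\<close>
  with \<open>P dvd T\<close> have "q * e \<le> q"
    using irreducible_not_dvd_low_degree[of m T P] unfolding degT eq by (metis not_le)
  with q e0 have e1: "e = 1"
    by simp
  have T: "T = l * mvar m ^ q + c"
    by (simp add: T_def e1 ring_hom.hom_one[OF mconst_hom])
  obtain k where k: "T = P * k"
    using \<open>P dvd T\<close> by blast
  with \<open>T \<noteq> 0\<close> have k0: "k \<noteq> 0"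
    by auto
  have "mdeg m k = 0"
    using k degT P0 k0 eq e1 by (simp add: mdeg_mult)
  then obtain k' where "to_poly m k = [:k':]"
    unfolding mdeg_def by (rule degree_eq_zeroE)
  then have "lead_coeff (to_poly m k) = k"
    using poly_to_poly[of m k] by simp
  moreover have "lead_coeff (to_poly m T) = l"
  proof -
    have "coeff (to_poly m T) q = l"
      using q by (simp add: to_T e1 ring_hom.hom_one[OF mconst_hom] coeff_pCons split: nat.splits)
    then show ?thesis
      using degT by (simp add: mdeg_def)
  qed
  \<comment> \<open>T and P have the same leading coefficient in x_m, so the cofactor k is
    1.\<close>
  ultimately have "l = l * k"
    by (simp add: k ring_hom.hom_mult[OF to_poly_hom] lead_coeff_mult l_def)
  with l0 have "T = P"
    by (simp add: k)
  show ?thesis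
  proof
    show "l \<in> poly_ring {..<m}" "- c \<in> poly_ring {..<m}" "l \<noteq> 0"
      using lX cX l0 by (auto intro: subring.uminus_closed[OF subring_poly_ring])
    \<comment> \<open>A common factor of l and c is free of x_m and divides P; its cofactor would be
      a unit, leaving P of degree 0 in x_m.\<close>
    show "\<not> p dvd - c" if p: "irreducible p" "p dvd l" for p
    proof
      assume "p dvd - c"
      then have "p dvd T"
        using p by (auto simp: T)
      then obtain r where r: "P = p * r"
        unfolding \<open>T = P\<close> by blast
      have "mdeg m p = 0"
        using poly_ring_dvd_closed[OF lX p(2) l0] by (intro mdeg_eq_0) auto
      moreover have "r dvd 1"
        using irreducibleD[OF P(1) r] irreducible_not_unit[OF p(1)] by blast
      then have "mdeg m r = 0"
        using mdeg_eq_0[OF unit_in_poly_ring, of r m "{}"] by simp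
      ultimately show False
        using degP P0 r by (auto simp: mdeg_mult)
    qed
    have "mpoly_subst F T = 0"
      by (simp add: \<open>T = P\<close> PF)
    moreover have "mpoly_subst F (mvar m) = g"
      by (simp add: F_def)
    ultimately have "mpoly_subst F l * g ^ q + mpoly_subst F c = 0"
      by (simp add: T ring_hom.hom_mult[OF mpoly_subst_hom] ring_hom.hom_add[OF mpoly_subst_hom]
        ring_hom.hom_power[OF mpoly_subst_hom])
    then show "mpoly_subst f l * g ^ (CHAR('k) ^ \<nu>) = mpoly_subst f (- c)"
      using lX cX by (simp add: subst_F q_def ring_hom.hom_uminus[OF mpoly_subst_hom] eq_neg_iff_add_eq_0)
  qed
qed

section \<open>The generated subalgebra and its radical\<close>

lemma generated_subalgebra_iff:
  fixes f :: "nat \<Rightarrow> 'k::comm_ring_1 mpoly"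
  shows "p \<in> generated_subalgebra (f ` X) \<longleftrightarrow> (\<exists>w\<in>poly_ring X. p = mpoly_subst f w)"
proof
  assume "p \<in> generated_subalgebra (f ` X)"
  then show "\<exists>w\<in>poly_ring X. p = mpoly_subst f w"
  proof induction
    case (gen p)
    then obtain i where "i \<in> X" "p = f i" by blast
    then show ?case
      by (intro bexI[of _ "mvar i"]) auto
  next
    case (const c)
    show ?case
      by (intro bexI[of _ "mconst c"]) auto
  next
    case (add p q)
    then obtain w w' where "w \<in> poly_ring X" "p = mpoly_subst f w" "w' \<in> poly_ring X" "q = mpoly_subst f w'"
      by blast
    then show ?case
      by (intro bexI[of _ "w + w'"])
        (auto simp: ring_hom.hom_add[OF mpoly_subst_hom] intro: subring.add_closed[OF subring_poly_ring])
  next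
    case (mult p q)
    then obtain w w' where "w \<in> poly_ring X" "p = mpoly_subst f w" "w' \<in> poly_ring X" "q = mpoly_subst f w'"
      by blast
    then show ?case
      by (intro bexI[of _ "w * w'"])
        (auto simp: ring_hom.hom_mult[OF mpoly_subst_hom] intro: subring.mult_closed[OF subring_poly_ring])
  qed
next
  let ?G = "generated_subalgebra (f ` X)"
  have "subring ?G"
  proof
    show "0 \<in> ?G" "1 \<in> ?G"
      using generated_subalgebra.const[of 0 "f ` X"] generated_subalgebra.const[of 1 "f ` X"]
      by (simp_all add: ring_hom.hom_zero[OF mconst_hom] ring_hom.hom_one[OF mconst_hom])
    show "- x \<in> ?G" if "x \<in> ?G" for x
      using generated_subalgebra.mult[OF generated_subalgebra.const[of "- 1"] that]
      by (simp add: ring_hom.hom_uminus[OF mconst_hom] ring_hom.hom_one[OF mconst_hom])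
  qed (auto intro: generated_subalgebra.intros)
  moreover assume "\<exists>w\<in>poly_ring X. p = mpoly_subst f w"
  then obtain w where "w \<in> poly_ring X" "p = mpoly_subst f w" by blast
  ultimately show "p \<in> ?G"
    unfolding mpoly_subst_def
    using subring.insertion_closed[of ?G mconst X f w] generated_subalgebra.intros(1,2)[of _ "f ` X"]
    by blast
qed

text \<open>Additivity of the Frobenius map, applied to x = (x - y) + y.\<close>

lemma power_CHAR_inj:
  fixes x y :: "'k::idom"
  assumes "CHAR('k) > 0" "x ^ (CHAR('k) ^ \<nu>) = y ^ (CHAR('k) ^ \<nu>)"
  shows "x = y"
proof -
  have "prime CHAR('k)"
    using assms(1) by (rule prime_CHAR_semidom)
  then have "((x - y) + y) ^ (CHAR('k) ^ \<nu>) = (x - y) ^ (CHAR('k) ^ \<nu>) + y ^ (CHAR('k) ^ \<nu>)"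
    by (rule freshmans_dream') simp
  with assms(2) have "(x - y) ^ (CHAR('k) ^ \<nu>) = 0"
    by simp
  then show ?thesis
    by simp
qed

text \<open>A power of g is a polynomial in f, so its value depends on those of f only; injectivity
  of Frobenius carries this over to g.\<close>

lemma radical_chi_subset_determined_polys:
  fixes f :: "nat \<Rightarrow> 'k::alg_closed_field mpoly"
  assumes "CHAR('k) > 0"
  shows "radical_chi n CHAR('k) (generated_subalgebra (f ` {..<m})) \<subseteq> determined_polys n m f"
proof
  fix g assume "g \<in> radical_chi n CHAR('k) (generated_subalgebra (f ` {..<m}))"
  then obtain \<nu> w where g: "g \<in> poly_ring {..<n}" and w: "w \<in> poly_ring {..<m}"
    and pow: "g ^ (CHAR('k) ^ \<nu>) = mpoly_subst f w"
    unfolding radical_chi_def generated_subalgebra_iff by blast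
  have "mpoly_eval a g = mpoly_eval b g"
    if "\<forall>i<m. mpoly_eval a (f i) = mpoly_eval b (f i)" for a b
  proof (rule power_CHAR_inj[OF assms])
    have "mpoly_eval a g ^ (CHAR('k) ^ \<nu>) = mpoly_eval (\<lambda>i. mpoly_eval a (f i)) w" for a
      by (simp flip: ring_hom.hom_power[OF mpoly_eval_hom] mpoly_eval_subst add: pow)
    moreover have "mpoly_eval (\<lambda>i. mpoly_eval a (f i)) w = mpoly_eval (\<lambda>i. mpoly_eval b (f i)) w"
      using w by (rule mpoly_eval_cong) (use that in auto)
    ultimately show "mpoly_eval a g ^ (CHAR('k) ^ \<nu>) = mpoly_eval b g ^ (CHAR('k) ^ \<nu>)"
      by simp
  qed
  with g show "g \<in> determined_polys n m f"
    by (simp add: determined_polys_def)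
qed

section \<open>Dimension of the complement of the range\<close>

lemma poly_range_iff:
  assumes "\<And>i. i < m \<Longrightarrow> f i \<in> poly_ring {..<n}" "y \<in> affine_space m"
  shows "y \<in> poly_range n m f \<longleftrightarrow> (\<exists>a. \<forall>i<m. mpoly_eval a (f i) = y i)"
proof
  assume "y \<in> poly_range n m f"
  then show "\<exists>a. \<forall>i<m. mpoly_eval a (f i) = y i"
    by (auto simp: poly_range_def)
next
  assume "\<exists>a. \<forall>i<m. mpoly_eval a (f i) = y i"
  then obtain a where a: "\<forall>i<m. mpoly_eval a (f i) = y i" by blast
  let ?a = "restrict a {..<n}"
  have "y = (\<lambda>i\<in>{..<m}. mpoly_eval ?a (f i))"
  proof
    fix i show "y i = (\<lambda>i\<in>{..<m}. mpoly_eval ?a (f i)) i"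
    proof (cases "i < m")
      case True
      then show ?thesis
        using a by (simp add: mpoly_eval_restrict[OF assms(1)])
    next
      case False
      then show ?thesis
        using PiE_arb[of y "{..<m}" _ i] assms(2) by (simp add: affine_space_def)
    qed
  qed
  moreover have "?a \<in> affine_space n"
    by (simp add: affine_space_def)
  ultimately show "y \<in> poly_range n m f"
    unfolding poly_range_def by blast
qed

lemma finite_independent_cards: "finite {card S |S. S \<subseteq> {..<m::nat} \<and> Q S}"
proof (rule finite_subset)
  show "{card S |S. S \<subseteq> {..<m} \<and> Q S} \<subseteq> card ` Pow {..<m}"
    by auto
qed auto

lemma alg_dim_ge:
  assumes "A \<noteq> {}" "S \<subseteq> {..<m}" "vanishing_ideal m A \<inter> poly_ring S = {0}"
  shows "int (card S) \<le> alg_dim m A"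
proof -
  have "card S \<in> {card S |S. S \<subseteq> {..<m} \<and> vanishing_ideal m A \<inter> poly_ring S = {0}}"
    using assms(2,3) by blast
  with finite_independent_cards
  have "card S \<le> Max {card S |S. S \<subseteq> {..<m} \<and> vanishing_ideal m A \<inter> poly_ring S = {0}}"
    by (rule Max_ge)
  then show ?thesis
    using assms(1) by (simp add: alg_dim_def)
qed

lemma alg_dim_le:
  fixes A :: "(nat \<Rightarrow> 'k::comm_ring_1) set"
  assumes "\<And>S. S \<subseteq> {..<m} \<Longrightarrow> vanishing_ideal m A \<inter> poly_ring S = {0} \<Longrightarrow> int (card S) \<le> d"
    and "- 1 \<le> d"
  shows "alg_dim m A \<le> d"
proof (cases "A = {}")
  case False
  let ?D = "{card S |S. S \<subseteq> {..<m} \<and> vanishing_ideal m A \<inter> poly_ring S = {0}}"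
  obtain a where "a \<in> A"
    using False by blast
  \<comment> \<open>\<open>Max\<close> is informative only on a nonempty set; the empty set of
    variables supplies a member.\<close>
  have "p = 0" if p: "p \<in> vanishing_ideal m A" "p \<in> poly_ring {}" for p
  proof -
    obtain c where c: "p = mconst c"
      using poly_ring_empty[OF p(2)] by blast
    with p(1) \<open>a \<in> A\<close> have "c = 0"
      by (auto simp: vanishing_ideal_def)
    then show ?thesis
      using c by simp
  qed
  then have "vanishing_ideal m A \<inter> poly_ring {} = {0}"
    by (auto simp: vanishing_ideal_def ring_hom.hom_zero[OF mpoly_eval_hom]
      intro: subring.zero_closed[OF subring_poly_ring])
  then have "?D \<noteq> {}"
    by blast
  with finite_independent_cards have "Max ?D \<in> ?D"
    by (rule Max_in)
  then obtain S where "Max ?D = card S" "S \<subseteq> {..<m}" "vanishing_ideal m A \<inter> poly_ring S = {0}"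
    by blast
  then have "int (Max ?D) \<le> d"
    using assms(1) by simp
  then show ?thesis
    using False by (simp add: alg_dim_def)
qed (use assms(2) in \<open>simp add: alg_dim_def\<close>)

text \<open>In s(f) g^q = r(f), an irreducible factor p of s would make the range miss all points
  with p = 0 and r \<noteq> 0. The polynomials vanishing on these are multiples of p, so m - 1
  variables would be independent on the closure.\<close>

lemma almost_surjective_imp_determined_subset:
  fixes f :: "nat \<Rightarrow> 'k::alg_closed_field mpoly"
  assumes char: "CHAR('k) > 0"
    and f: "\<And>i. i < m \<Longrightarrow> f i \<in> poly_ring {..<n}"
    and indep: "algebraically_independent m f"
    and surj: "almost_surjective n m f"
  shows "determined_polys n m f \<subseteq> radical_chi n CHAR('k) (generated_subalgebra (f ` {..<m}))"
proof
  fix g assume g: "g \<in> determined_polys n m f"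
  obtain s r \<nu> where s: "s \<in> poly_ring {..<m}" and r: "r \<in> poly_ring {..<m}" and "s \<noteq> 0"
    and coprime: "\<And>p. irreducible p \<Longrightarrow> p dvd s \<Longrightarrow> \<not> p dvd r"
    and eq: "mpoly_subst f s * g ^ (CHAR('k) ^ \<nu>) = mpoly_subst f r"
    using determined_imp_purely_inseparable[OF char f indep g] by blast
  have "s dvd 1"
  proof (rule ccontr)
    assume "\<not> s dvd 1"
    then obtain p where p: "irreducible p" "p dvd s"
      using ex_irreducible_divisor[OF \<open>s \<noteq> 0\<close>] by blast
    have pX: "p \<in> poly_ring {..<m}"
      using s p(2) \<open>s \<noteq> 0\<close> by (rule poly_ring_dvd_closed)
    define N where "N = affine_space m - poly_range n m f"
    have N: "restrict x {..<m} \<in> N" if x: "mpoly_eval x p = 0" "mpoly_eval x r \<noteq> 0" for x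
    proof -
      have aff: "restrict x {..<m} \<in> affine_space m"
        by (simp add: affine_space_def)
      have "\<not> (\<exists>a. \<forall>i<m. mpoly_eval a (f i) = restrict x {..<m} i)"
      proof
        assume "\<exists>a. \<forall>i<m. mpoly_eval a (f i) = restrict x {..<m} i"
        then obtain a where a: "\<And>i. i < m \<Longrightarrow> mpoly_eval a (f i) = x i"
          by auto
        have ev: "mpoly_eval a (mpoly_subst f q) = mpoly_eval x q" if "q \<in> poly_ring {..<m}" for q
          unfolding mpoly_eval_subst using that by (rule mpoly_eval_cong) (use a in auto)
        have "mpoly_eval x s = 0"
          using p(2) x(1) by (auto elim!: dvdE simp: ring_hom.hom_mult[OF mpoly_eval_hom])
        moreover have "mpoly_eval x s * mpoly_eval a (g ^ (CHAR('k) ^ \<nu>)) = mpoly_eval x r"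
          using arg_cong[OF eq, of "mpoly_eval a"]
          by (simp add: ring_hom.hom_mult[OF mpoly_eval_hom] ev s r)
        ultimately show False
          using x(2) by simp
      qed
      then show ?thesis
        using aff poly_range_iff[of m f n, OF f aff] by (simp add: N_def)
    qed
    define Z where "Z = zariski_closure m N"
    have "N \<subseteq> Z"
      by (simp add: Z_def zariski_closure_def hull_subset)
    have ideal: "p dvd h" if h: "h \<in> vanishing_ideal m Z" for h
    proof -
      \<comment> \<open>The factor r covers the zeros of p that the range may attain.\<close>
      have "mpoly_eval x (h * r) = 0" if "mpoly_eval x p = 0" for x
      proof (cases "mpoly_eval x r = 0")
        case False
        then have "restrict x {..<m} \<in> Z"
          using N[OF that] \<open>N \<subseteq> Z\<close> by blast
        with h have "mpoly_eval (restrict x {..<m}) h = 0" "h \<in> poly_ring {..<m}"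
          by (auto simp: vanishing_ideal_def)
        then show ?thesis
          by (simp add: mpoly_eval_restrict ring_hom.hom_mult[OF mpoly_eval_hom])
      qed (simp add: ring_hom.hom_mult[OF mpoly_eval_hom])
      then have "p dvd h * r"
        by (rule nullstellensatz_irreducible[OF p(1)])
      then show ?thesis
        using irreducible_dvd_mult_iff[OF p(1)] coprime[OF p] by blast
    qed
    have "Z \<noteq> {}"
    proof
      assume "Z = {}"
      then have "1 \<in> vanishing_ideal m Z"
        by (simp add: vanishing_ideal_def subring.one_closed[OF subring_poly_ring])
      then show False
        using ideal p(1) by (auto simp: irreducible_def)
    qed
    obtain v where v: "mdeg v p > 0"
      using irreducible_ex_var[OF p(1)] .
    then have "v < m"
      using mdeg_eq_0[OF pX, of v] by (cases "v < m") auto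
    \<comment> \<open>A nonzero multiple of p contains x_v, so none lies in
      \<open>poly_ring ?S\<close>.\<close>
    let ?S = "{..<m} - {v}"
    have "h = 0" if "h \<in> vanishing_ideal m Z" "h \<in> poly_ring ?S" for h
      using irreducible_not_dvd_low_degree[of v h p] ideal[OF that(1)] mdeg_eq_0[OF that(2), of v] v by auto
    then have "vanishing_ideal m Z \<inter> poly_ring ?S = {0}"
      by (auto simp: vanishing_ideal_def ring_hom.hom_zero[OF mpoly_eval_hom]
        intro: subring.zero_closed[OF subring_poly_ring])
    then have "int (card ?S) \<le> alg_dim m Z"
      using \<open>Z \<noteq> {}\<close> by (intro alg_dim_ge) auto
    moreover have "alg_dim m Z \<le> int m - 2"
      using surj by (simp add: almost_surjective_def Z_def N_def)
    ultimately show False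
      using \<open>v < m\<close> by simp
  qed
  \<comment> \<open>With s a unit, multiplying by its inverse k puts the power of g into the
    subalgebra.\<close>
  then obtain k where k: "1 = s * k" by blast
  have "mpoly_subst f (k * r) = mpoly_subst f (s * k) * g ^ (CHAR('k) ^ \<nu>)"
    by (simp add: ring_hom.hom_mult[OF mpoly_subst_hom] ac_simps flip: eq)
  then have "g ^ (CHAR('k) ^ \<nu>) = mpoly_subst f (k * r)"
    by (simp add: ring_hom.hom_one[OF mpoly_subst_hom] flip: k)
  moreover have "k dvd 1"
    by (simp add: k)
  then have "k * r \<in> poly_ring {..<m}"
    by (intro subring.mult_closed[OF subring_poly_ring] r) (rule unit_in_poly_ring)
  ultimately have "g ^ (CHAR('k) ^ \<nu>) \<in> generated_subalgebra (f ` {..<m})"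
    unfolding generated_subalgebra_iff by blast
  then show "g \<in> radical_chi n CHAR('k) (generated_subalgebra (f ` {..<m}))"
    using g unfolding radical_chi_def determined_polys_def by blast
qed

text \<open>Q^(N+1) / P is determined by f, so a power of it is a polynomial w in f. Algebraic
  independence turns this into an identity between p, w and q, from which p divides a power of
  q.\<close>

lemma range_dense_in_hypersurfaces:
  fixes f :: "nat \<Rightarrow> 'k::alg_closed_field mpoly"
  assumes char: "CHAR('k) > 0"
    and f: "\<And>i. i < m \<Longrightarrow> f i \<in> poly_ring {..<n}"
    and indep: "algebraically_independent m f"
    and sub: "determined_polys n m f \<subseteq> radical_chi n CHAR('k) (generated_subalgebra (f ` {..<m}))"
    and p: "irreducible p" "p \<in> poly_ring {..<m}" and q: "q \<in> poly_ring {..<m}"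
    and zero: "\<And>x. mpoly_eval x p = 0 \<Longrightarrow> \<exists>a. \<forall>i<m. mpoly_eval a (f i) = x i \<Longrightarrow> mpoly_eval x q = 0"
  shows "p dvd q"
proof -
  interpret S: ring_hom "mpoly_subst f" by (rule mpoly_subst_hom)
  have inj: "w = w'" if "w \<in> poly_ring {..<m}" "w' \<in> poly_ring {..<m}" "mpoly_subst f w = mpoly_subst f w'" for w w'
  proof -
    have "w - w' \<in> poly_ring {..<m}"
      using that by (intro subring.diff_closed[OF subring_poly_ring])
    moreover have "mpoly_subst f (w - w') = 0"
      using that by (simp add: S.hom_diff)
    ultimately show ?thesis
      using indep by (auto simp: algebraically_independent_def)
  qed
  define P where "P = mpoly_subst f p"
  define Q where "Q = mpoly_subst f q"
  have P0: "P \<noteq> 0"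
  proof
    assume "P = 0"
    then have "p = 0"
      by (intro inj[OF p(2) subring.zero_closed[OF subring_poly_ring]]) (simp add: P_def)
    with p(1) show False
      by simp
  qed
  have zero': "mpoly_eval a Q = 0" if "mpoly_eval a P = 0" for a
    unfolding Q_def mpoly_eval_subst
  proof (rule zero)
    show "mpoly_eval (\<lambda>i. mpoly_eval a (f i)) p = 0"
      using that by (simp add: P_def mpoly_eval_subst)
  qed blast
  obtain N where "P dvd Q ^ N"
    using nullstellensatz_principal[OF P0 zero'] by blast
  then obtain g where g: "Q ^ N = P * g" by blast
  \<comment> \<open>The additional factor Q makes h vanish where P does; there the values of the
    quotient g need not be determined by f.\<close>
  define h where "h = g * Q"
  have h: "P * h = Q ^ Suc N"
    by (simp add: h_def g)
  have QX: "Q \<in> poly_ring {..<n}"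
    unfolding Q_def using f q by (intro mpoly_subst_closed) auto
  have "g \<in> poly_ring {..<n}" if "Q \<noteq> 0"
  proof (rule poly_ring_dvd_closed)
    show "Q ^ N \<in> poly_ring {..<n}"
      using QX by (rule subring.power_closed[OF subring_poly_ring])
  qed (use that g in auto)
  then have hX: "h \<in> poly_ring {..<n}"
    unfolding h_def using QX by (cases "Q = 0") (auto intro: subring.mult_closed[OF subring_poly_ring]
      subring.zero_closed[OF subring_poly_ring])
  have "mpoly_eval a h = mpoly_eval b h"
    if ab: "\<forall>i<m. mpoly_eval a (f i) = mpoly_eval b (f i)" for a b
  proof -
    have ev: "mpoly_eval a (mpoly_subst f w) = mpoly_eval b (mpoly_subst f w)" if "w \<in> poly_ring {..<m}" for w
      unfolding mpoly_eval_subst using that by (rule mpoly_eval_cong) (use ab in auto)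
    have ev_P: "mpoly_eval a P = mpoly_eval b P" and ev_Q: "mpoly_eval a Q = mpoly_eval b Q"
      unfolding P_def Q_def using p q by (auto intro: ev)
    have Ph: "mpoly_eval c P * mpoly_eval c h = mpoly_eval c Q ^ Suc N" for c
      using arg_cong[OF h, of "mpoly_eval c"]
      by (simp only: ring_hom.hom_mult[OF mpoly_eval_hom] ring_hom.hom_power[OF mpoly_eval_hom])
    show ?thesis
    proof (cases "mpoly_eval a P = 0")
      case True
      then have "mpoly_eval a Q = 0" "mpoly_eval b Q = 0"
        using zero' ev_Q by auto
      then show ?thesis
        by (simp add: h_def ring_hom.hom_mult[OF mpoly_eval_hom])
    next
      case False
      have "mpoly_eval b P * mpoly_eval a h = mpoly_eval b P * mpoly_eval b h"
        using Ph[of a] Ph[of b] unfolding ev_P ev_Q by simp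
      with False show ?thesis
        by (simp add: ev_P)
    qed
  qed
  then have "h \<in> determined_polys n m f"
    using hX by (simp add: determined_polys_def)
  with sub obtain \<nu> w where w: "w \<in> poly_ring {..<m}" "h ^ (CHAR('k) ^ \<nu>) = mpoly_subst f w"
    unfolding radical_chi_def generated_subalgebra_iff by blast
  define l where "l = CHAR('k) ^ \<nu>"
  have "mpoly_subst f (p ^ l * w) = (P * h) ^ l"
    by (simp add: S.hom_mult S.hom_power P_def power_mult_distrib w l_def)
  also have "\<dots> = mpoly_subst f ((q ^ Suc N) ^ l)"
    by (simp only: h S.hom_power Q_def)
  finally have eq: "mpoly_subst f (p ^ l * w) = mpoly_subst f ((q ^ Suc N) ^ l)" .
  have "p ^ l * w = (q ^ Suc N) ^ l"
    by (rule inj[OF _ _ eq])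
      (intro subring.mult_closed[OF subring_poly_ring] subring.power_closed[OF subring_poly_ring] p q w)+
  \<comment> \<open>The exponent l is positive because the characteristic is.\<close>
  moreover have "p dvd p ^ l * w"
    using char by (simp add: l_def dvd_power)
  ultimately have "p dvd (q ^ Suc N) ^ l"
    by simp
  then show ?thesis
    using irreducible_dvd_power[OF p(1)] by blast
qed

text \<open>The range contains all points with Q \<noteq> 0, and a generic part of every irreducible
  hypersurface. So for every v some nonzero polynomial free of x_v vanishes on the complement, and
  no m - 1 variables are independent on its closure.\<close>

lemma radical_imp_almost_surjective:
  fixes f :: "nat \<Rightarrow> 'k::alg_closed_field mpoly"
  assumes char: "CHAR('k) > 0" and "m > 0"
    and f: "\<And>i. i < m \<Longrightarrow> f i \<in> poly_ring {..<n}"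
    and indep: "algebraically_independent m f"
    and sub: "determined_polys n m f \<subseteq> radical_chi n CHAR('k) (generated_subalgebra (f ` {..<m}))"
  shows "almost_surjective n m f"
proof -
  define R where "R x \<longleftrightarrow> (\<exists>a. \<forall>i<m. mpoly_eval a (f i) = x i)" for x
  have constr: "constructible {..<m} R"
    unfolding R_def[abs_def] by (rule constructible_range[OF f])
  obtain Q where Q: "Q \<in> poly_ring {..<m}" "Q \<noteq> 0" "\<And>x. mpoly_eval x Q \<noteq> 0 \<Longrightarrow> R x"
    using constr disjI1[OF refl]
  proof (cases rule: constructible_generic)
    case (generic q)
    then show ?thesis
      using that by (auto simp: ring_hom.hom_zero[OF mpoly_eval_hom])
  next
    case (negligible q)
    then have "mpoly_subst f q = 0"
      by (subst mpoly_subst_eq_0_iff[of _ m]) (auto simp: R_def ring_hom.hom_zero[OF mpoly_eval_hom])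
    with negligible indep show ?thesis
      by (auto simp: algebraically_independent_def)
  qed
  have hyper: "\<exists>q\<in>poly_ring {..<m}. \<not> p dvd q \<and> (\<forall>x. mpoly_eval x p = 0 \<longrightarrow> mpoly_eval x q \<noteq> 0 \<longrightarrow> R x)"
    if p: "irreducible p" "p \<in> poly_ring {..<m}" for p
    using constr disjI2[OF p(1)]
  proof (cases rule: constructible_generic)
    case (negligible q)
    have "p dvd q"
      by (rule range_dense_in_hypersurfaces[OF char f indep sub p negligible(1)])
        (use negligible(3) in \<open>auto simp: R_def\<close>)
    with negligible show ?thesis by blast
  qed blast
  \<comment> \<open>W is a product over the irreducible factors p of Q; each contributes a nonzero
    polynomial free of x_v that vanishes at the points of p = 0 outside the range.\<close>
  have elim: "\<exists>W\<in>poly_ring ({..<m} - {v}). W \<noteq> 0 \<and> (\<forall>x. \<not> R x \<longrightarrow> mpoly_eval x Q \<noteq> 0 \<or> mpoly_eval x W = 0)" for v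
    using Q(2,1)
  proof (induction Q rule: mpoly_factor_induct)
    case (unit u)
    then obtain k where k: "1 = u * k" by blast
    have "mpoly_eval x u * mpoly_eval x k = 1" for x
      by (simp flip: ring_hom.hom_mult[OF mpoly_eval_hom] k add: ring_hom.hom_one[OF mpoly_eval_hom])
    then have "mpoly_eval x u \<noteq> 0" for x
      by (metis mult_zero_left zero_neq_one)
    then show ?case
      by (intro bexI[of _ 1]) (auto intro: subring.one_closed[OF subring_poly_ring])
  next
    case (mult p r)
    have p0: "p * r \<noteq> 0"
      using mult by (auto simp: irreducible_def)
    have pX: "p \<in> poly_ring {..<m}" and rX: "r \<in> poly_ring {..<m}"
      using poly_ring_dvd_closed[OF mult.prems _ p0] by auto
    obtain W where W: "W \<in> poly_ring ({..<m} - {v})" "W \<noteq> 0"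
        "\<forall>x. \<not> R x \<longrightarrow> mpoly_eval x r \<noteq> 0 \<or> mpoly_eval x W = 0"
      using mult.IH rX by blast
    obtain V where V: "V \<in> poly_ring ({..<m} - {v})" "V \<noteq> 0"
        "\<forall>x. \<not> R x \<longrightarrow> mpoly_eval x p \<noteq> 0 \<or> mpoly_eval x V = 0"
    proof (cases "mdeg v p > 0")
      case True
      obtain q where q: "q \<in> poly_ring {..<m}" "\<not> p dvd q"
        "\<forall>x. mpoly_eval x p = 0 \<longrightarrow> mpoly_eval x q \<noteq> 0 \<longrightarrow> R x"
        using hyper[OF mult.hyps(1) pX] by blast
      obtain u w where uw: "u * p + w * q \<noteq> 0" "u * p + w * q \<in> poly_ring ({..<m} - {v})"
        using eliminate[OF mult.hyps(1) pX True q(1,2)] by blast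
      show ?thesis
      proof (rule that[OF uw(2,1)], intro allI impI)
        fix x assume "\<not> R x"
        then have "mpoly_eval x p \<noteq> 0 \<or> mpoly_eval x q = 0"
          using q(3) by blast
        then show "mpoly_eval x p \<noteq> 0 \<or> mpoly_eval x (u * p + w * q) = 0"
          by (auto simp: ring_hom.hom_mult[OF mpoly_eval_hom] ring_hom.hom_add[OF mpoly_eval_hom])
      qed
    next
      \<comment> \<open>A factor p without x_v serves as its own V.\<close>
      case False
      then have "p \<in> poly_ring ({..<m} - {v})"
        using pX by (intro poly_ring_Diff) auto
      then show ?thesis
        using p0 by (intro that[of p]) auto
    qed
    have "V * W \<in> poly_ring ({..<m} - {v})"
      using V W by (intro subring.mult_closed[OF subring_poly_ring])
    moreover have "\<forall>x. \<not> R x \<longrightarrow> mpoly_eval x (p * r) \<noteq> 0 \<or> mpoly_eval x (V * W) = 0"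
      using V(3) W(3) by (auto simp: ring_hom.hom_mult[OF mpoly_eval_hom])
    ultimately show ?case
      using V(2) W(2) by (intro bexI[of _ "V * W"]) auto
  qed
  define N where "N = affine_space m - poly_range n m f"
  have N: "\<not> R x" if "x \<in> N" for x
    using that poly_range_iff[of m f n x, OF f] by (auto simp: N_def R_def)
  have "alg_dim m (zariski_closure m N) \<le> int m - 2"
  proof (rule alg_dim_le)
    fix S assume S: "S \<subseteq> {..<m}" "vanishing_ideal m (zariski_closure m N) \<inter> poly_ring S = {0}"
    show "int (card S) \<le> int m - 2"
    proof (rule ccontr)
      assume "\<not> int (card S) \<le> int m - 2"
      \<comment> \<open>At most one variable is missing from S; W for that variable, or for any if
        none is missing, contradicts the independence of S.\<close>
      then have "card ({..<m} - S) \<le> 1"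
        using S(1) by (subst card_Diff_subset) (auto intro: finite_subset)
      then obtain v where "{..<m} - {v} \<subseteq> S"
        by (cases "card ({..<m} - S) = 0") (auto simp: card_1_singleton_iff le_Suc_eq)
      moreover obtain W where W: "W \<in> poly_ring ({..<m} - {v})" "W \<noteq> 0"
        "\<forall>x. \<not> R x \<longrightarrow> mpoly_eval x Q \<noteq> 0 \<or> mpoly_eval x W = 0"
        using elim by blast
      ultimately have WS: "W \<in> poly_ring S"
        using poly_ring_mono by blast
      then have Wm: "W \<in> poly_ring {..<m}"
        using S(1) poly_ring_mono by blast
      let ?V = "{x \<in> affine_space m. \<forall>p\<in>{W}. mpoly_eval x p = 0}"
      have "algebraic_set m ?V"
        unfolding algebraic_set_def using Wm by (intro exI[of _ "{W}"]) auto
      moreover have "N \<subseteq> ?V"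
      proof
        fix x assume x: "x \<in> N"
        then have "mpoly_eval x Q = 0"
          using N Q(3) by blast
        then show "x \<in> ?V"
          using W(3) N[OF x] x by (auto simp: N_def)
      qed
      ultimately have "zariski_closure m N \<subseteq> ?V"
        unfolding zariski_closure_def by (intro hull_minimal)
      then have "W \<in> vanishing_ideal m (zariski_closure m N)"
        using Wm by (auto simp: vanishing_ideal_def)
      with WS S(2) W(2) show False
        by blast
    qed
  \<comment> \<open>The dimension -1 of the empty set is within the bound m - 2 because m is
    positive.\<close>
  qed (use \<open>m > 0\<close> in simp)
  then show ?thesis
    by (simp add: almost_surjective_def N_def)
qed

theorem theorem3p5:
  fixes f :: "nat \<Rightarrow> 'k::alg_closed_field mpoly" and m n :: nat
  assumes "CHAR('k) > 0"
    and "m > 0" and "n > 0"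
    and "\<And>i. i < m \<Longrightarrow> f i \<in> poly_ring {..<n}"
    and "algebraically_independent m f"
  shows "determined_polys n m f = radical_chi n CHAR('k) (generated_subalgebra (f ` {..<m}))
     \<longleftrightarrow> almost_surjective n m f"
proof
  assume "determined_polys n m f = radical_chi n CHAR('k) (generated_subalgebra (f ` {..<m}))"
  then show "almost_surjective n m f"
    by (intro radical_imp_almost_surjective assms) auto
next
  assume "almost_surjective n m f"
  then show "determined_polys n m f = radical_chi n CHAR('k) (generated_subalgebra (f ` {..<m}))"
    by (intro subset_antisym almost_surjective_imp_determined_subset radical_chi_subset_determined_polys assms)
qed

end
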